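(* Let $(T(t))_{t\ge0}$ be a $C_0$-semigroup on a Banach space $X$ with generator $A:\operatorname{dom}(A)\subseteq X\to X$, let $V$ be a Banach space that embeds continuously into $X$, and let $B:\operatorname{dom}(B)\subseteq X\to X$ be a linear operator such that $\operatorname{dom}(A)\subseteq\operatorname{dom}(B)$ and $B|_{X_1}\in\mathcal{L}(X_1,X)$, where $X_1$ denotes $\operatorname{dom}(A)$ with the graph norm. Assume that there are constants $C\ge1$, $\alpha>0$, $\beta\in[0,1)$, $q\in(0,1)$ and $t_0>0$ such that: 1. $T(t)X\subseteq V$ and $\|T(t)\|_{X\to V}\le Ct^{-\alpha}$ for all $t\in(0,1]$; 2. $\int_0^{t_0}\|BT(s)x\|_X\,ds\le q\|x\|_X$ for all $x\in\operatorname{dom}(A)$; 3. $\|T(t)\|_{V\to V}\le C$ for all $t\in(0,1]$, and $BT(t)x\in V$ with $\|BT(t)x\|_V\le Ct^{-\beta}\|x\|_V$ whenever $x\in V$ and $t\in(0,1]$ are such that $T(t)x\in\operatorname{dom}(B)$. Assume also that at least one of the following holds: (i) $V$ is separable; (ii) the closed unit ball of $V$ is closed in $X$. If $(T(t))_{t\ge0}$ is immediately differentiable, then there exists a constant $\widetilde C>0$ such that the perturbed semigroup $(S(t))_{t\ge0}$ generated by $A+B$ satisfies \[ S(t)X\subseteq V\quad\text{and}\quad\|S(t)\|_{X\to V}\le\widetilde Ct^{-\alpha} \] for all $t\in(0,1]$.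
   Context: $\mathcal{L}(X,Y)$ is the space of bounded linear operators from $X$ to $Y$. Under hypothesis 2, the Miyadera–Voigt perturbation theorem ensures that $A+B$ with $\operatorname{dom}(A+B)=\operatorname{dom}(A)$ generates a $C_0$-semigroup $(S(t))_{t\ge0}$ on $X$; this is the perturbed semigroup. A $C_0$-semigroup is immediately differentiable if $t\mapsto T(t)x$ is differentiable on $(0,\infty)$ for every $x\in X$, equivalently $T(t)X\subseteq\operatorname{dom}(A)$ for all $t>0$. $\|\cdot\|_{X\to V}$, $\|\cdot\|_{V\to V}$ denote operator norms (the bound on $\|T(t)\|_{V\to V}$ includes that $T(t)V\subseteq V$). *)

theory Defs
  imports "HOL-Analysis.Analysis"
begin

text \<open>
  Scalars are real. A complex Banach space with complex-linear operators is in particular a real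
  one, with the same norms, domains, limits and generator.

  Semigroups are functions on \<open>real\<close> of which only the values at \<open>t \<ge> 0\<close> matter.
  An unbounded operator is a pair of a domain \<open>D\<close> and a total function that is meaningful
  only on \<open>D\<close>.
\<close>

definition c0_semigroup :: "(real \<Rightarrow> 'a::banach \<Rightarrow>\<^sub>L 'a) \<Rightarrow> bool" where
  "c0_semigroup T \<longleftrightarrow>
     T 0 = id_blinfun \<and>
     (\<forall>s\<ge>0. \<forall>t\<ge>0. T (s + t) = T s o\<^sub>L T t) \<and>
     (\<forall>x. continuous_on {0..} (\<lambda>t. T t x))"

definition is_generator ::
    "(real \<Rightarrow> 'a::banach \<Rightarrow>\<^sub>L 'a) \<Rightarrow> 'a set \<Rightarrow> ('a \<Rightarrow> 'a) \<Rightarrow> bool" where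
  "is_generator T D A \<longleftrightarrow>
     D = {x. \<exists>y. ((\<lambda>h. (T h x - x) /\<^sub>R h) \<longlongrightarrow> y) (at_right 0)} \<and>
     (\<forall>x\<in>D. ((\<lambda>h. (T h x - x) /\<^sub>R h) \<longlongrightarrow> A x) (at_right 0))"

definition immediately_differentiable :: "(real \<Rightarrow> 'a::banach \<Rightarrow>\<^sub>L 'a) \<Rightarrow> bool" where
  "immediately_differentiable T \<longleftrightarrow> (\<forall>x. \<forall>t>0. (\<lambda>s. T s x) differentiable (at t))"

definition linear_operator :: "'a::real_vector set \<Rightarrow> ('a \<Rightarrow> 'b::real_vector) \<Rightarrow> bool" where
  "linear_operator D B \<longleftrightarrow>
     subspace D \<and>
     (\<forall>x\<in>D. \<forall>y\<in>D. B (x + y) = B x + B y) \<and>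
     (\<forall>c. \<forall>x\<in>D. B (c *\<^sub>R x) = c *\<^sub>R B x)"

definition graph_norm :: "('a::real_normed_vector \<Rightarrow> 'a) \<Rightarrow> 'a \<Rightarrow> real" where
  "graph_norm A x = norm x + norm (A x)"

text \<open>
  A Banach space \<open>V\<close> embedded continuously into \<open>X\<close> is a Banach space type
  \<open>'v\<close> with an injective bounded linear map \<open>j\<close> into \<open>X\<close>. As a subset of
  \<open>X\<close> it is \<open>range j\<close>, and the \<open>V\<close>-norm of \<open>y \<in> range j\<close>
  is \<open>norm (inv j y)\<close>.
\<close>

definition continuous_embedding :: "('v::banach \<Rightarrow> 'a::banach) \<Rightarrow> bool" where
  "continuous_embedding j \<longleftrightarrow> bounded_linear j \<and> inj j"

text \<open>
  \<open>S\<close> takes values in \<open>V\<close> and has norm at most \<open>c\<close> as an operator into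
  \<open>V\<close>. Boundedness is stated because \<open>onorm\<close> is meaningless without it. For an
  operator \<open>S\<close> on \<open>X\<close>, the bound on the norm from \<open>X\<close> to \<open>V\<close>
  is \<open>opnorm_into_le j S c\<close>, and the one from \<open>V\<close> to \<open>V\<close> is
  \<open>opnorm_into_le j (S \<circ> j) c\<close>.
\<close>

definition opnorm_into_le ::
    "('v::banach \<Rightarrow> 'a::banach) \<Rightarrow> ('b::banach \<Rightarrow> 'a) \<Rightarrow> real \<Rightarrow> bool" where
  "opnorm_into_le j S c \<longleftrightarrow>
     range S \<subseteq> range j \<and> bounded_linear (inv j \<circ> S) \<and> onorm (inv j \<circ> S) \<le> c"

end

theory Submission
  imports Defs
begin

text \<open>
  Since \<open>T\<close> is immediately differentiable, \<open>R s = B T(s)\<close> is defined on all of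
  \<open>X\<close> for \<open>s > 0\<close>, and \<open>S\<close> solves the Volterra equation
  \<open>S(t) = T(t) + \<integral>\<^sub>0\<^sup>t S(t - s) R(s) ds\<close> on \<open>X\<close>. Its Dyson series has
  terms \<open>S\<^sub>0 = T\<close> and \<open>S\<^sub>n\<^sub>+\<^sub>1(t) = \<integral>\<^sub>0\<^sup>t S\<^sub>n(t - s) R(s) ds\<close>, with bounds
  \<open>M\<^sub>n t\<^sup>-\<^sup>\<alpha>\<close> from \<open>X\<close> to \<open>V\<close> and \<open>K\<^sub>n\<close> on \<open>V\<close>. The integral
  is split at \<open>s = (1 - \<mu>) t\<close>. Below this point \<open>S\<^sub>n(t - s)\<close> smooths at the cost
  \<open>M\<^sub>n (\<mu> t)\<^sup>-\<^sup>\<alpha>\<close> and \<open>R\<close> has integral at most \<open>q\<close>; above it \<open>R(s)\<close> itself maps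
  into \<open>V\<close>, because \<open>T((1 - \<mu>) t / 2)\<close> can be split off. With \<open>\<mu>\<close> chosen such
  that \<open>q \<mu>\<^sup>-\<^sup>\<alpha> = sqrt q\<close> this gives \<open>M\<^sub>n\<^sub>+\<^sub>1 \<le> sqrt q M\<^sub>n + const K\<^sub>n\<close>, while for small
  times \<open>K\<^sub>n\<^sub>+\<^sub>1 \<le> K\<^sub>n / 2\<close>. So the series converges geometrically in \<open>V\<close>, and the
  semigroup law reaches the remaining times.

  The orbits \<open>t \<mapsto> T(t) x = T(\<epsilon>) T(t - \<epsilon>) x\<close> are continuous in \<open>V\<close> for
  \<open>t > 0\<close>. Hence all the integrals are Henstock-Kurzweil integrals in \<open>V\<close> of functions
  that are continuous on an open interval and dominated by a real integrable function.
\<close>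

section \<open>Uniform boundedness and improper integrals\<close>

text \<open>Baire category argument: the closed sets \<open>E n\<close> cover the complete space, so
  one of them contains a ball. Differences of two points of this ball reach every direction, which
  turns the pointwise bound into a bound on operator norms.\<close>

lemma uniform_boundedness:
  fixes F :: "'i \<Rightarrow> 'a::banach \<Rightarrow>\<^sub>L 'b::real_normed_vector"
  assumes ptw: "\<And>x. \<exists>c. \<forall>i\<in>I. norm (F i x) \<le> c"
  shows "\<exists>c. \<forall>i\<in>I. norm (F i) \<le> c"
proof -
  define E where "E n = {x. \<forall>i\<in>I. norm (F i x) \<le> real n}" for n :: nat
  have closed_E: "closed (E n)" for n
  proof -
    have "E n = (\<Inter>i\<in>I. {x. norm (F i x) \<le> real n})" by (auto simp: E_def)
    moreover have "closed {x. norm (F i x) \<le> real n}" for i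
      by (intro closed_Collect_le continuous_intros)
    ultimately show ?thesis by auto
  qed
  have "\<exists>n. interior (E n) \<noteq> {}"
  proof (rule ccontr)
    assume "\<not> ?thesis"
    then have "euclidean interior_of \<Union>(range E) = {}"
      using closed_E by (intro Baire_category_alt) (auto simp: completely_metrizable_space_euclidean)
    moreover have "x \<in> \<Union>(range E)" for x
    proof -
      obtain c where "\<forall>i\<in>I. norm (F i x) \<le> c" using ptw by blast
      moreover obtain n where "c \<le> real n" using real_arch_simple by blast
      ultimately have "x \<in> E n" by (force simp: E_def)
      then show ?thesis by blast
    qed
    then have "\<Union>(range E) = UNIV" by blast
    ultimately show False by simp
  qed
  then obtain n z e where "e > 0" and ball: "ball z e \<subseteq> E n"
    by (metis ex_in_conv mem_interior)
  have "norm (F i) \<le> 4 * real n / e" if i: "i \<in> I" for i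
  proof (rule norm_blinfun_bound)
    fix x
    show "norm (F i x) \<le> 4 * real n / e * norm x"
    proof (cases "x = 0")
      case False
      \<comment> \<open>Rescaling \<open>x\<close> to norm \<open>e / 2\<close> keeps both
        \<open>z\<close> and \<open>z + y\<close> in the ball, so \<open>F i y\<close> is a
        difference of two vectors of norm at most \<open>n\<close>.\<close>
      define y where "y = (e / (2 * norm x)) *\<^sub>R x"
      have "norm y = e / 2" using False \<open>e > 0\<close> by (simp add: y_def)
      then have "z + y \<in> E n" "z \<in> E n"
        using ball \<open>e > 0\<close> by (auto simp: dist_norm subset_iff)
      then have "norm (F i y) \<le> 2 * real n"
        using i norm_triangle_ineq4[of "F i (z + y)" "F i z"]
        by (force simp: E_def blinfun.add_right)
      moreover have "norm (F i y) = e / (2 * norm x) * norm (F i x)"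
        using \<open>e > 0\<close> by (simp add: y_def blinfun.scaleR_right)
      ultimately show ?thesis using False \<open>e > 0\<close> by (simp add: field_simps)
    qed (simp add: blinfun.zero_right)
  qed (use \<open>e > 0\<close> in simp)
  then show ?thesis by blast
qed

text \<open>The Volterra integrands are controlled only strictly inside the interval, since the
  operator families are singular or arbitrary at time 0. Redefining the dominating function at the
  two end points leaves its integral unchanged.\<close>

lemma integral_norm_bound_interior:
  fixes f :: "real \<Rightarrow> 'b::banach"
  assumes "f integrable_on {a..b}" and g: "g integrable_on {a..b}"
    and bound: "\<And>s. \<lbrakk>a < s; s < b\<rbrakk> \<Longrightarrow> norm (f s) \<le> g s"
  shows "norm (integral {a..b} f) \<le> integral {a..b} g"
proof -
  define g' where "g' s = (if s \<in> {a, b} then norm (f s) else g s)" for s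
  have "g' integrable_on {a..b}"
    by (rule integrable_spike_finite[OF _ _ g, of "{a, b}"]) (auto simp: g'_def)
  then have "norm (integral {a..b} f) \<le> integral {a..b} g'"
    using assms by (intro integral_norm_bound_integral) (auto simp: g'_def)
  also have "integral {a..b} g' = integral {a..b} g"
    by (rule integral_spike[of "{a, b}"]) (auto simp: g'_def)
  finally show ?thesis .
qed

text \<open>
  Hake's theorem for a continuous integrand: the antiderivative is uniformly continuous, hence extends
  to the closed interval, where the fundamental theorem of calculus applies. The library's dominated
  convergence is for Euclidean values only.
\<close>

lemma integrable_on_dominated:
  fixes f :: "real \<Rightarrow> 'b::banach"
  assumes cont: "continuous_on {a<..<b} f"
    and g: "g integrable_on {a..b}"
    and bound: "\<And>s. \<lbrakk>a < s; s < b\<rbrakk> \<Longrightarrow> norm (f s) \<le> g s"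
  shows "f integrable_on {a..b}" and "norm (integral {a..b} f) \<le> integral {a..b} g"
proof -
  show int_f: "f integrable_on {a..b}"
  proof (cases "a < b")
    case False
    then show ?thesis using integrable_continuous_interval[of b b f] by (cases "a = b") auto
  next
    case True
    define c where "c = (a + b) / 2"
    have c: "a < c" "c < b" using True by (auto simp: c_def)
    \<comment> \<open>The antiderivative is based at an interior point, because integrability up to
      \<open>a\<close> or \<open>b\<close> is still to be shown.\<close>
    define F where "F t = (if c \<le> t then integral {c..t} f else - integral {t..c} f)" for t
    define G where "G t = integral {a..t} g" for t
    have f_int: "f integrable_on {s..t}" if "a < s" "t < b" for s t
      using that by (intro integrable_continuous_interval continuous_on_subset[OF cont]) auto
    have g_int: "g integrable_on {s..t}" if "a \<le> s" "t \<le> b" for s t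
      using that by (intro integrable_on_subinterval[OF g]) auto
    have F_diff: "F t - F s = integral {s..t} f" if "a < s" "s \<le> t" "t < b" for s t
      using that c Henstock_Kurzweil_Integration.integral_combine[where a=c and c=s and b=t and f=f] Henstock_Kurzweil_Integration.integral_combine[where a=s and c=c and b=t and f=f]
        Henstock_Kurzweil_Integration.integral_combine[where a=s and c=t and b=c and f=f] f_int[of c t] f_int[of s t] f_int[of s c]
      by (auto simp: F_def algebra_simps)
    have G_diff: "G t - G s = integral {s..t} g" if "a \<le> s" "s \<le> t" "t \<le> b" for s t
      using that Henstock_Kurzweil_Integration.integral_combine[where a=a and c=s and b=t and f=g] g_int[of a t] by (simp add: G_def algebra_simps)
    have FG: "norm (F t - F s) \<le> G t - G s" if "a < s" "s \<le> t" "t < b" for s t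
      using that bound f_int[of s t] g_int[of s t]
      by (auto simp: F_diff G_diff intro!: integral_norm_bound_integral)
    \<comment> \<open>Increments of \<open>F\<close> are dominated by those of \<open>G\<close>,
      which is continuous up to the end points; this transfers uniform continuity to
      \<open>F\<close>.\<close>
    have FG_dist: "dist (F t) (F s) \<le> dist (G t) (G s)" if "s \<in> {a<..<b}" "t \<in> {a<..<b}" for s t
      using that FG[of s t] FG[of t s] by (cases "s \<le> t") (auto simp: dist_norm norm_minus_commute)
    have "uniformly_continuous_on {a..b} G"
      unfolding G_def using g
      by (intro compact_uniformly_continuous indefinite_integral_continuous_1) auto
    then have "uniformly_continuous_on {a<..<b} F"
      unfolding uniformly_continuous_on_def
    proof (intro allI impI)
      fix e :: real assume G: "\<forall>e>0. \<exists>d>0. \<forall>x\<in>{a..b}. \<forall>x'\<in>{a..b}. dist x' x < d \<longrightarrow> dist (G x') (G x) < e"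
        and "0 < e"
      then obtain d where "d > 0" and d: "\<And>x x'. \<lbrakk>x \<in> {a..b}; x' \<in> {a..b}; dist x' x < d\<rbrakk> \<Longrightarrow> dist (G x') (G x) < e"
        by blast
      have "dist (F x') (F x) < e" if "x \<in> {a<..<b}" "x' \<in> {a<..<b}" "dist x' x < d" for x x'
        using FG_dist[OF that(1,2)] d[of x x'] that by auto
      then show "\<exists>d>0. \<forall>x\<in>{a<..<b}. \<forall>x'\<in>{a<..<b}. dist x' x < d \<longrightarrow> dist (F x') (F x) < e"
        using \<open>d > 0\<close> by blast
    qed
    then obtain H where H: "uniformly_continuous_on (closure {a<..<b}) H"
        "\<And>x. x \<in> {a<..<b} \<Longrightarrow> F x = H x"
      by (rule uniformly_continuous_on_extension_on_closure) blast
    have "continuous_on {a..b} H"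
      using uniformly_continuous_imp_continuous[OF H(1)] True by simp
    moreover have "(H has_vector_derivative f x) (at x)" if x: "x \<in> {a<..<b}" for x
    proof -
      define s where "s = (a + x) / 2"
      define t where "t = (x + b) / 2"
      have st: "a < s" "s < x" "x < t" "t < b" using x by (auto simp: s_def t_def)
      have "((\<lambda>u. integral {s..u} f) has_vector_derivative f x) (at x within {s..t})"
        using st by (intro integral_has_vector_derivative continuous_on_subset[OF cont]) auto
      then have "((\<lambda>u. integral {s..u} f) has_vector_derivative f x) (at x)"
        using st by (simp add: at_within_Icc_at)
      then have "((\<lambda>u. F s + integral {s..u} f) has_vector_derivative f x) (at x)"
        by (auto intro!: derivative_eq_intros)
      moreover have "F s + integral {s..u} f = H u" if "u \<in> {s<..<t}" for u
        using that st F_diff[of s u] H(2)[of u] by (auto simp: diff_eq_eq)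
      ultimately show ?thesis
        using st by (elim has_vector_derivative_transform_within_open[where S="{s<..<t}"]) auto
    qed
    ultimately have "(f has_integral H b - H a) {a..b}"
      using True by (intro fundamental_theorem_of_calculus_interior) auto
    then show ?thesis by blast
  qed
  then show "norm (integral {a..b} f) \<le> integral {a..b} g"
    using g bound by (rule integral_norm_bound_interior)
qed

text \<open>Monotone convergence for the truncations of \<open>g\<close> to \<open>{e n..b}\<close>.
  It is applied on the half-open interval, because the truncations need not converge to
  \<open>g\<close> at 0; the point 0 is added afterwards as a null set.\<close>

lemma nonneg_improper_integral:
  fixes g :: "real \<Rightarrow> real"
  assumes "0 < b" and cont: "continuous_on {0<..b} g"
    and nonneg: "\<And>s. 0 \<le> g s"
    and bound: "\<And>e. \<lbrakk>0 < e; e < b\<rbrakk> \<Longrightarrow> integral {e..b} g \<le> c"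
  shows "g integrable_on {0..b}" and "integral {0..b} g \<le> c"
proof -
  define e where "e n = b / (2 + real n)" for n
  have e: "0 < e n" "e n < b" "e (Suc n) \<le> e n" for n
    using \<open>0 < b\<close> by (auto simp: e_def field_simps intro!: add_pos_nonneg)
  have elim: "e \<longlonglongrightarrow> 0" 
    unfolding e_def by (intro tendsto_divide_0[OF tendsto_const] filterlim_at_top_imp_at_infinity
      filterlim_tendsto_add_at_top[OF tendsto_const filterlim_real_sequentially])
  define f where "f = (\<lambda>n s. if s \<in> {e n..b} then g s else 0)"
  have g_int: "g integrable_on {e n..b}" for n
    using e[of n] by (intro integrable_continuous_interval continuous_on_subset[OF cont]) auto
  have sub: "{e n..b} \<inter> {0<..b} = {e n..b}" "{0<..b} \<inter> {e n..b} = {e n..b}" for n using e[of n] by auto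
  have f_int: "f n integrable_on {0<..b}" for n
    using g_int[of n] integrable_restrict_Int[of "{e n..b}" g "{0<..b}"] by (simp add: f_def sub)
  have f_eq: "integral {0<..b} (f n) = integral {e n..b} g" for n
    using integral_restrict_Int[of "{0<..b}" "{e n..b}" g] by (simp add: f_def sub)
  have lim: "(\<lambda>n. f n s) \<longlonglongrightarrow> g s" if "s \<in> {0<..b}" for s
  proof -
    have "\<forall>\<^sub>F n in sequentially. e n < s" using elim that by (intro order_tendstoD) auto
    then have "\<forall>\<^sub>F n in sequentially. f n s = g s"
      by eventually_elim (use that in \<open>auto simp: f_def\<close>)
    then show ?thesis by (rule tendsto_eventually)
  qed
  have "g integrable_on {0<..b} \<and> (\<lambda>n. integral {0<..b} (f n)) \<longlonglongrightarrow> integral {0<..b} g"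
  proof (rule monotone_convergence_increasing[OF f_int _ lim])
    show "f n s \<le> f (Suc n) s" for n s
      using e[of n] nonneg[of s] by (auto simp: f_def)
    have "norm (integral {0<..b} (f n)) \<le> c" for n
      using bound[OF e(1,2)] e(1)[of n] nonneg by (simp add: f_eq integral_nonneg[OF g_int])
    then show "bounded (range (\<lambda>n. integral {0<..b} (f n)))" by (auto simp: bounded_iff)
  qed
  moreover have "integral {0<..b} (f n) \<le> c" for n using bound e(1,2) by (simp add: f_eq)
  ultimately have *: "g integrable_on {0<..b}" "integral {0<..b} g \<le> c"
    by (auto intro: LIMSEQ_le_const2)
  have spike: "negligible {x \<in> {0..b} - {0<..b}. g x \<noteq> 0}" "negligible {x \<in> {0<..b} - {0..b}. g x \<noteq> 0}"
    by (rule negligible_subset[of "{0}"]; force)+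
  show "g integrable_on {0..b}" using integrable_spike_set[OF *(1)] spike by blast
  show "integral {0..b} g \<le> c" using *(2) integral_spike_set[of "{0..b}" "{0<..b}" g] spike by simp
qed

section \<open>Semigroups and generators\<close>

text \<open>Passes between derivatives of orbits and the difference quotients by which generators
  are defined.\<close>

lemma has_vector_derivative_iff_slope:
  "(f has_vector_derivative D) (at t) \<longleftrightarrow> ((\<lambda>h. (f (t + h) - f t) /\<^sub>R h) \<longlongrightarrow> D) (at 0)"
proof -
  have "(f has_vector_derivative D) (at t) \<longleftrightarrow>
      ((\<lambda>h. norm (f (t + h) - f t - h *\<^sub>R D) / norm h) \<longlongrightarrow> 0) (at 0)"
    by (simp add: has_vector_derivative_def has_derivative_at bounded_linear_scaleR_left)
  also have "\<dots> \<longleftrightarrow> ((\<lambda>h. norm ((f (t + h) - f t) /\<^sub>R h - D)) \<longlongrightarrow> 0) (at 0)"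
  proof (rule filterlim_cong[OF refl refl])
    show "\<forall>\<^sub>F h in at 0. norm (f (t + h) - f t - h *\<^sub>R D) / norm h = norm ((f (t + h) - f t) /\<^sub>R h - D)"
    proof (rule eventually_at_filter[THEN iffD2], rule always_eventually, intro allI impI)
      fix h :: real assume "h \<noteq> 0"
      then have "(f (t + h) - f t) /\<^sub>R h - D = (f (t + h) - f t - h *\<^sub>R D) /\<^sub>R h"
        by (simp add: scaleR_diff_right)
      then show "norm (f (t + h) - f t - h *\<^sub>R D) / norm h = norm ((f (t + h) - f t) /\<^sub>R h - D)"
        by (simp add: divide_inverse_commute)
    qed
  qed
  also have "\<dots> \<longleftrightarrow> ((\<lambda>h. (f (t + h) - f t) /\<^sub>R h) \<longlongrightarrow> D) (at 0)"
    by (simp add: tendsto_norm_zero_iff Lim_null[symmetric])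
  finally show ?thesis .
qed

lemma c0_semigroup_add:
  "c0_semigroup T \<Longrightarrow> 0 \<le> s \<Longrightarrow> 0 \<le> t \<Longrightarrow> T (s + t) x = T s (T t x)"
  by (simp add: c0_semigroup_def)

lemma c0_semigroup_0: "c0_semigroup T \<Longrightarrow> T 0 x = x"
  by (simp add: c0_semigroup_def)

lemma c0_semigroup_continuous_on: "c0_semigroup T \<Longrightarrow> continuous_on {0..} (\<lambda>t. T t x)"
  by (simp add: c0_semigroup_def)

text \<open>Each orbit over a compact time interval is compact, hence bounded; uniform boundedness
  makes the bound independent of the vector.\<close>

lemma c0_semigroup_bounded:
  assumes T: "c0_semigroup T"
  obtains M where "M \<ge> 1" "\<And>t x. 0 \<le> t \<Longrightarrow> t \<le> b \<Longrightarrow> norm (T t x) \<le> M * norm x"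
proof -
  have "\<exists>c. \<forall>t\<in>{0..b}. norm (T t) \<le> c"
  proof (rule uniform_boundedness)
    fix x
    have "compact ((\<lambda>t. T t x) ` {0..b})"
      by (intro compact_continuous_image continuous_on_subset[OF c0_semigroup_continuous_on[OF T]]) auto
    then show "\<exists>c. \<forall>t\<in>{0..b}. norm (T t x) \<le> c"
      using compact_imp_bounded bounded_iff by (metis (no_types, lifting) image_eqI)
  qed
  then obtain c where c: "\<forall>t\<in>{0..b}. norm (T t) \<le> c" by blast
  have "norm (T t x) \<le> max c 1 * norm x" if "0 \<le> t" "t \<le> b" for t x
    using c that norm_blinfun[of "T t" x]
    by (meson atLeastAtMost_iff max.coboundedI1 mult_right_mono norm_ge_zero order_trans)
  then show ?thesis by (intro that[of "max c 1"]) auto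
qed

text \<open>Joint continuity in time and vector: local boundedness handles the change of the vector,
  strong continuity the change of time. It serves for difference quotients to which a moving
  operator is applied.\<close>

lemma c0_semigroup_tendsto:
  assumes T: "c0_semigroup T" and f: "(f \<longlongrightarrow> t) F" "\<forall>\<^sub>F h in F. 0 \<le> f h" and "0 \<le> t"
    and y: "(y \<longlongrightarrow> y\<^sub>0) F"
  shows "((\<lambda>h. T (f h) (y h)) \<longlongrightarrow> T t y\<^sub>0) F"
proof -
  obtain M where M: "\<And>s x. 0 \<le> s \<Longrightarrow> s \<le> t + 1 \<Longrightarrow> norm (T s x) \<le> M * norm x"
    using c0_semigroup_bounded[OF T] by metis
  have "\<forall>\<^sub>F h in F. f h < t + 1" using f(1) by (rule order_tendstoD) simp
  then have "\<forall>\<^sub>F h in F. norm (T (f h) (y h - y\<^sub>0)) \<le> norm (y h - y\<^sub>0) * M"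
    using f(2) by eventually_elim (use M in \<open>simp add: mult.commute\<close>)
  moreover have "((\<lambda>h. y h - y\<^sub>0) \<longlongrightarrow> 0) F" using y by (simp add: Lim_null[symmetric])
  ultimately have "((\<lambda>h. T (f h) (y h - y\<^sub>0)) \<longlongrightarrow> 0) F"
    by (rule tendsto_0_le[rotated])
  moreover have "((\<lambda>h. T (f h) y\<^sub>0) \<longlongrightarrow> T t y\<^sub>0) F"
    using f(2) \<open>0 \<le> t\<close>
    by (intro continuous_on_tendsto_compose[OF c0_semigroup_continuous_on[OF T] f(1)]) auto
  ultimately have "((\<lambda>h. T (f h) (y h - y\<^sub>0) + T (f h) y\<^sub>0) \<longlongrightarrow> 0 + T t y\<^sub>0) F"
    by (rule tendsto_add)
  then show ?thesis by (simp add: blinfun.diff_right)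
qed

section \<open>Generators and derivatives of orbits\<close>

lemma generator_tendsto:
  "is_generator T D A \<Longrightarrow> x \<in> D \<Longrightarrow> ((\<lambda>h. (T h x - x) /\<^sub>R h) \<longlongrightarrow> A x) (at_right 0)"
  by (simp add: is_generator_def)

lemma generatorI:
  assumes "is_generator T D A" "((\<lambda>h. (T h x - x) /\<^sub>R h) \<longlongrightarrow> y) (at_right 0)"
  shows "x \<in> D" "A x = y"
proof -
  show D: "x \<in> D" using assms by (auto simp: is_generator_def)
  show "A x = y"
    using tendsto_unique[OF _ generator_tendsto[OF assms(1) D] assms(2)] by simp
qed

lemma generator_diff:
  assumes G: "is_generator T D A" and "x \<in> D" "y \<in> D"
  shows "x - y \<in> D" "A (x - y) = A x - A y"
proof -
  have "((\<lambda>h. (T h x - x) /\<^sub>R h - (T h y - y) /\<^sub>R h) \<longlongrightarrow> A x - A y) (at_right 0)"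
    using assms by (intro tendsto_diff generator_tendsto)
  then have "((\<lambda>h. (T h (x - y) - (x - y)) /\<^sub>R h) \<longlongrightarrow> A x - A y) (at_right 0)"
    by (simp add: blinfun.diff_right algebra_simps)
  then show "x - y \<in> D" "A (x - y) = A x - A y" using generatorI[OF G] by blast+
qed

lemma generator_invariant:
  assumes T: "c0_semigroup T" and G: "is_generator T D A" and "x \<in> D" "0 \<le> t"
  shows "T t x \<in> D" "A (T t x) = T t (A x)"
proof -
  have "((\<lambda>h. T t ((T h x - x) /\<^sub>R h)) \<longlongrightarrow> T t (A x)) (at_right 0)"
    by (intro tendsto_intros generator_tendsto[OF G \<open>x \<in> D\<close>])
  moreover have "\<forall>\<^sub>F h in at_right 0. T t ((T h x - x) /\<^sub>R h) = (T h (T t x) - T t x) /\<^sub>R h"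
    using eventually_at_right_less[of 0]
  proof eventually_elim
    case (elim h)
    then show ?case
      using c0_semigroup_add[OF T, of h t x] c0_semigroup_add[OF T, of t h x] \<open>0 \<le> t\<close>
      by (simp add: blinfun.scaleR_right blinfun.diff_right add.commute)
  qed
  ultimately have "((\<lambda>h. (T h (T t x) - T t x) /\<^sub>R h) \<longlongrightarrow> T t (A x)) (at_right 0)"
    by (rule Lim_transform_eventually)
  then show "T t x \<in> D" "A (T t x) = T t (A x)" using generatorI[OF G] by blast+
qed

text \<open>The two one-sided slopes are treated separately. On the right \<open>T t\<close> factors
  out of the quotient; on the left only \<open>T (t - h)\<close> does, so joint continuity is
  needed.\<close>

lemma c0_semigroup_has_vector_derivative:
  assumes T: "c0_semigroup T" and G: "is_generator T D A" and x: "x \<in> D" and "0 < t"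
  shows "((\<lambda>s. T s x) has_vector_derivative T t (A x)) (at t)"
  unfolding has_vector_derivative_iff_slope
proof (rule filterlim_split_at)
  have ev: "\<forall>\<^sub>F h in at_right 0. 0 < h \<and> h < t"
    using \<open>0 < t\<close> by (simp add: eventually_at_right_less eventually_conj eventually_at_right_real[of 0 t, simplified])
  have "((\<lambda>h. T t ((T h x - x) /\<^sub>R h)) \<longlongrightarrow> T t (A x)) (at_right 0)"
    by (intro tendsto_intros generator_tendsto[OF G x])
  moreover have "\<forall>\<^sub>F h in at_right 0. T t ((T h x - x) /\<^sub>R h) = (T (t + h) x - T t x) /\<^sub>R h"
    using ev by eventually_elim (use \<open>0 < t\<close> in
      \<open>simp add: blinfun.scaleR_right blinfun.diff_right c0_semigroup_add[OF T]\<close>)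
  ultimately show "((\<lambda>h. (T (t + h) x - T t x) /\<^sub>R h) \<longlongrightarrow> T t (A x)) (at_right 0)"
    by (rule Lim_transform_eventually)
  have "((\<lambda>h. t - h) \<longlongrightarrow> t - 0) (at_right 0)" by (intro tendsto_intros)
  then have "((\<lambda>h. T (t - h) ((T h x - x) /\<^sub>R h)) \<longlongrightarrow> T t (A x)) (at_right 0)"
    using ev \<open>0 < t\<close>
    by (intro c0_semigroup_tendsto[OF T] generator_tendsto[OF G x]) (auto elim: eventually_mono)
  moreover have "\<forall>\<^sub>F h in at_right 0.
      T (t - h) ((T h x - x) /\<^sub>R h) = (T (t + - h) x - T t x) /\<^sub>R (- h)"
    using ev
  proof eventually_elim
    case (elim h)
    then show ?case
      using c0_semigroup_add[OF T, of "t - h" h x]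
      by (simp add: blinfun.scaleR_right blinfun.diff_right algebra_simps)
  qed
  ultimately have "((\<lambda>h. (T (t + - h) x - T t x) /\<^sub>R (- h)) \<longlongrightarrow> T t (A x)) (at_right 0)"
    by (rule Lim_transform_eventually)
  then show "((\<lambda>h. (T (t + h) x - T t x) /\<^sub>R h) \<longlongrightarrow> T t (A x)) (at_left 0)"
    by (simp add: filterlim_at_left_to_right)
qed

text \<open>By the semigroup law, the right difference quotient of the orbit at \<open>t\<close> is
  the quotient defining the generator at \<open>T t x\<close>.\<close>

lemma immediately_differentiable_generator:
  assumes T: "c0_semigroup T" and G: "is_generator T D A" and "immediately_differentiable T" and "0 < t"
  shows "T t x \<in> D" "((\<lambda>s. T s x) has_vector_derivative A (T t x)) (at t)"
proof -
  obtain y where y: "((\<lambda>s. T s x) has_vector_derivative y) (at t)"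
    using assms(3) \<open>0 < t\<close> unfolding immediately_differentiable_def
    by (meson vector_derivative_works)
  then have "((\<lambda>h. (T (t + h) x - T t x) /\<^sub>R h) \<longlongrightarrow> y) (at_right 0)"
    unfolding has_vector_derivative_iff_slope by (simp add: filterlim_at_split)
  moreover have "\<forall>\<^sub>F h in at_right 0. (T (t + h) x - T t x) /\<^sub>R h = (T h (T t x) - T t x) /\<^sub>R h"
    using eventually_at_right_less[of 0] by eventually_elim
      (use \<open>0 < t\<close> c0_semigroup_add[OF T, of _ t x] in \<open>simp add: add.commute[of t]\<close>)
  ultimately have "((\<lambda>h. (T h (T t x) - T t x) /\<^sub>R h) \<longlongrightarrow> y) (at_right 0)"
    by (rule Lim_transform_eventually)
  then show "T t x \<in> D" "((\<lambda>s. T s x) has_vector_derivative A (T t x)) (at t)"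
    using generatorI[OF G] y by blast+
qed

text \<open>The derivative of \<open>S (t - s) (T s x)\<close> in \<open>s\<close> is
  \<open>- S (t - s) (B (T s x))\<close>, the contributions of \<open>A\<close> cancelling.
  Immediate differentiability puts \<open>T s x\<close> into \<open>D\<close> for
  \<open>s > 0\<close> and arbitrary \<open>x\<close>, so the identity holds on all of X.\<close>

lemma variation_of_constants:
  assumes T: "c0_semigroup T" and GT: "is_generator T D A" and diff: "immediately_differentiable T"
    and S: "c0_semigroup S" and GS: "is_generator S D (\<lambda>x. A x + B x)" and "0 \<le> t"
  shows "((\<lambda>s. S (t - s) (B (T s x))) has_integral S t x - T t x) {0..t}"
proof -
  have "((\<lambda>s. - S (t - s) (B (T s x))) has_integral S (t - t) (T t x) - S (t - 0) (T 0 x)) {0..t}"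
  proof (rule fundamental_theorem_of_calculus_interior[OF \<open>0 \<le> t\<close>])
    show "continuous_on {0..t} (\<lambda>s. S (t - s) (T s x))"
      unfolding continuous_on_def
    proof (intro ballI c0_semigroup_tendsto[OF S])
      fix s assume s: "s \<in> {0..t}"
      show "\<forall>\<^sub>F s in at s within {0..t}. 0 \<le> t - s" by (auto simp: eventually_at_filter)
      have "continuous_on {0..t} (\<lambda>s. T s x)"
        by (rule continuous_on_subset[OF c0_semigroup_continuous_on[OF T]]) auto
      then show "((\<lambda>s. T s x) \<longlongrightarrow> T s x) (at s within {0..t})"
        using s by (simp add: continuous_on_def)
    qed (auto intro!: tendsto_intros)
    fix s assume s: "s \<in> {0<..<t}"
    define y where "y = T s x"
    have y: "y \<in> D" and T_slope: "((\<lambda>h. (T (s + h) x - y) /\<^sub>R h) \<longlongrightarrow> A y) (at 0)"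
      using immediately_differentiable_generator[OF T GT diff, of s x] s
      by (auto simp: y_def has_vector_derivative_iff_slope)
    have "((\<lambda>r. S r y) has_vector_derivative S (t - s) (A y + B y)) (at (t - s))"
      using s by (intro c0_semigroup_has_vector_derivative[OF S GS y]) auto
    moreover have "((\<lambda>r. t - r) has_vector_derivative -1) (at s)"
      by (auto intro!: derivative_eq_intros)
    ultimately have "(((\<lambda>r. S r y) \<circ> (\<lambda>r. t - r)) has_vector_derivative -1 *\<^sub>R S (t - s) (A y + B y)) (at s)"
      by (intro vector_diff_chain_at) auto
    then have S_slope: "((\<lambda>h. (S (t - (s + h)) y - S (t - s) y) /\<^sub>R h) \<longlongrightarrow> - S (t - s) (A y + B y)) (at 0)"
      by (simp add: has_vector_derivative_iff_slope o_def)
    have lim: "((\<lambda>h. t - (s + h)) \<longlongrightarrow> t - (s + 0)) (at 0)" by (intro tendsto_intros)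
    then have "\<forall>\<^sub>F h in at 0. 0 < t - (s + h)" using s by (intro order_tendstoD) auto
    then have "((\<lambda>h. S (t - (s + h)) ((T (s + h) x - y) /\<^sub>R h)) \<longlongrightarrow> S (t - s) (A y)) (at 0)"
      using lim s by (intro c0_semigroup_tendsto[OF S _ _ _ T_slope]) (auto elim: eventually_mono)
    \<comment> \<open>Product rule by hand: one slope moves only \<open>T\<close> under the operator
      \<open>S (t - (s + h))\<close>, the other moves only \<open>S\<close> at the fixed vector
      \<open>y\<close>.\<close>
    from tendsto_add[OF this S_slope]
    have "((\<lambda>h. (S (t - (s + h)) (T (s + h) x) - S (t - s) y) /\<^sub>R h) \<longlongrightarrow> - S (t - s) (B y)) (at 0)"
      by (simp add: blinfun.diff_right blinfun.add_right blinfun.scaleR_right algebra_simps)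
    then show "((\<lambda>s. S (t - s) (T s x)) has_vector_derivative - S (t - s) (B (T s x))) (at s)"
      by (simp add: has_vector_derivative_iff_slope y_def)
  qed
  from has_integral_neg[OF this] show ?thesis
    by (simp add: c0_semigroup_0[OF S] c0_semigroup_0[OF T])
qed

section \<open>The operators \<open>B T(s)\<close>\<close>

text \<open>\<open>B\<close> is bounded for the graph norm, and orbits starting in \<open>D\<close>
  are continuous in that norm because \<open>A\<close> commutes with \<open>T s\<close> on
  \<open>D\<close>.\<close>

lemma perturbed_orbit_continuous_domain:
  assumes T: "c0_semigroup T" and G: "is_generator T D A"
    and B: "linear_operator domB B" and D: "D \<subseteq> domB"
    and K: "\<And>x. x \<in> D \<Longrightarrow> norm (B x) \<le> K * graph_norm A x"
    and x: "x \<in> D"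
  shows "continuous_on {0..} (\<lambda>s. B (T s x))"
  unfolding continuous_on_def
proof
  fix s :: real assume s: "s \<in> {0..}"
  have bound: "norm (B (T r x) - B (T s x)) \<le> K * (norm (T r x - T s x) + norm (T r (A x) - T s (A x)))"
    if r: "r \<in> {0..}" for r
  proof -
    note inv = generator_invariant[OF T G x]
    have mem: "T r x \<in> D" "T s x \<in> D" using inv r s by auto
    have "B (T r x) = B (T r x - T s x) + B (T s x)"
      using B D generator_diff(1)[OF G mem] mem
      by (metis diff_add_cancel linear_operator_def subsetD)
    moreover have "norm (B (T r x - T s x)) \<le> K * graph_norm A (T r x - T s x)"
      by (rule K[OF generator_diff(1)[OF G mem]])
    ultimately show ?thesis
      using inv r s by (simp add: graph_norm_def generator_diff(2)[OF G mem])
  qed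
  have lim: "((\<lambda>r. T r y - T s y) \<longlongrightarrow> 0) (at s within {0..})" for y
    using c0_semigroup_continuous_on[OF T, of y] s by (simp add: continuous_on_def Lim_null[symmetric])
  have "((\<lambda>r. K * (norm (T r x - T s x) + norm (T r (A x) - T s (A x)))) \<longlongrightarrow> K * (0 + 0))
      (at s within {0..})"
    by (intro tendsto_intros tendsto_norm_zero lim)
  then have "((\<lambda>r. K * (norm (T r x - T s x) + norm (T r (A x) - T s (A x)))) \<longlongrightarrow> 0) (at s within {0..})"
    by simp
  then have "((\<lambda>r. B (T r x) - B (T s x)) \<longlongrightarrow> 0) (at s within {0..})"
    by (rule Lim_null_comparison[rotated]) (use bound in \<open>auto simp: eventually_at_filter\<close>)
  then show "((\<lambda>r. B (T r x)) \<longlongrightarrow> B (T s x)) (at s within {0..})"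
    by (simp add: Lim_null[symmetric])
qed

text \<open>For positive times a short initial piece \<open>T e\<close> can be split off; it maps
  every \<open>x\<close> into the domain, where the previous continuity result applies.\<close>

lemma perturbed_orbit_continuous:
  assumes T: "c0_semigroup T" and G: "is_generator T D A" and diff: "immediately_differentiable T"
    and B: "linear_operator domB B" and D: "D \<subseteq> domB"
    and K: "\<And>x. x \<in> D \<Longrightarrow> norm (B x) \<le> K * graph_norm A x"
  shows "continuous_on {0<..} (\<lambda>s. B (T s x))"
proof (rule continuous_at_imp_continuous_on, rule ballI)
  fix s :: real assume "s \<in> {0<..}"
  define e where "e = s / 2"
  have e: "0 < e" "e < s" using \<open>s \<in> {0<..}\<close> by (auto simp: e_def)
  have "continuous_on {e<..} (\<lambda>r. B (T (r - e) (T e x)))"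
    by (rule continuous_on_compose2[OF perturbed_orbit_continuous_domain[OF T G B D K]])
      (use e in \<open>auto intro!: continuous_intros immediately_differentiable_generator[OF T G diff]\<close>)
  moreover have "B (T (r - e) (T e x)) = B (T r x)" if "r \<in> {e<..}" for r
    using c0_semigroup_add[OF T, of "r - e" e x] e that by simp
  ultimately have "continuous_on {e<..} (\<lambda>r. B (T r x))"
    by (rule continuous_on_eq)
  then show "isCont (\<lambda>s. B (T s x)) s" using e by (simp add: continuous_on_eq_continuous_at)
qed

text \<open>The Miyadera bound is given on the domain only. It is applied to \<open>T d x\<close>,
  shifted in time by \<open>d\<close>, and extended to all \<open>x\<close> by letting
  \<open>d\<close> tend to 0; the truncated integrals then control the improper one.\<close>

lemma perturbed_orbit_integral:
  assumes T: "c0_semigroup T" and G: "is_generator T D A" and diff: "immediately_differentiable T"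
    and B: "linear_operator domB B" and D: "D \<subseteq> domB"
    and K: "\<And>x. x \<in> D \<Longrightarrow> norm (B x) \<le> K * graph_norm A x"
    and "0 < t"
    and q: "\<And>x. x \<in> D \<Longrightarrow> integral {0..t} (\<lambda>s. norm (B (T s x))) \<le> q * norm x"
  shows "(\<lambda>s. norm (B (T s x))) integrable_on {0..t}"
    and "integral {0..t} (\<lambda>s. norm (B (T s x))) \<le> q * norm x"
proof -
  let ?N = "\<lambda>s. norm (B (T s x))"
  have cont: "continuous_on {0<..} ?N"
    by (intro continuous_on_norm perturbed_orbit_continuous[OF T G diff B D K])
  have int: "?N integrable_on {a..b}" if "0 < a" for a b
    by (intro integrable_continuous_interval continuous_on_subset[OF cont]) (use that in auto)
  have "integral {e..t} ?N \<le> q * norm x" if e: "0 < e" "e < t" for e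
  proof (rule tendsto_lowerbound)
    have "((\<lambda>d. T d x) \<longlongrightarrow> T 0 x) (at_right 0)"
      using c0_semigroup_tendsto[OF T tendsto_ident_at[of 0 "{0<..}"] _ _ tendsto_const]
      by (simp add: eventually_at_filter)
    then show "((\<lambda>d. q * norm (T d x)) \<longlongrightarrow> q * norm x) (at_right 0)"
      by (intro tendsto_intros) (simp add: c0_semigroup_0[OF T])
    have "\<forall>\<^sub>F d in at_right 0. d \<in> {0<..<e}" using e(1) by (rule eventually_at_right_real)
    then show "\<forall>\<^sub>F d in at_right 0. integral {e..t} ?N \<le> q * norm (T d x)"
    proof eventually_elim
      case (elim d)
      \<comment> \<open>Since \<open>d < e\<close>, the shifted interval contains
        \<open>{e..t}\<close>, and the integrand is nonnegative.\<close>
      have "integral {e..t} ?N \<le> integral {0 + d..t + d} ?N"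
        by (intro integral_subset_le int) (use elim e in auto)
      also have "\<dots> = integral {0..t} (?N \<circ> (\<lambda>s. s + d))"
        by (intro integral_shift[symmetric] continuous_on_subset[OF cont]) (use elim in auto)
      also have "\<dots> = integral {0..t} (\<lambda>s. norm (B (T s (T d x))))"
        by (intro integral_cong) (use elim c0_semigroup_add[OF T, of _ d x] in auto)
      also have "\<dots> \<le> q * norm (T d x)"
        using elim by (intro q immediately_differentiable_generator[OF T G diff]) auto
      finally show ?case .
    qed
  qed simp
  moreover have "{0<..t} \<subseteq> {0<..}" by auto
  ultimately show "?N integrable_on {0..t}" "integral {0..t} ?N \<le> q * norm x"
    using nonneg_improper_integral[OF \<open>0 < t\<close> continuous_on_subset[OF cont], of "q * norm x"] by auto
qed

section \<open>Dyson series of a smoothing Volterra equation\<close>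

text \<open>\<open>R s\<close> abstracts B T(s), and \<open>V t\<close> is T(t) regarded as a map
  into the smaller space. \<open>R_smoothing\<close> reflects the factorisation B T(s - \<sigma>)
  T(\<sigma>). \<open>\<tau>_small\<close> says that \<open>C * s powr (- \<beta>)\<close> has
  integral at most 1/2 over \<open>{0..\<tau>}\<close>.\<close>

locale smoothing_volterra =
  fixes j :: "'v::banach \<Rightarrow> 'a::banach" and R :: "real \<Rightarrow> 'a \<Rightarrow> 'a" and V :: "real \<Rightarrow> 'a \<Rightarrow> 'v"
    and C \<alpha> \<beta> q \<tau> :: real
  assumes j: "bounded_linear j"
    and C: "1 \<le> C" and \<alpha>: "0 < \<alpha>" and \<beta>: "0 \<le> \<beta>" "\<beta> < 1" and q: "0 < q" "q < 1"
    and \<tau>: "0 < \<tau>" "\<tau> \<le> 1" and \<tau>_small: "C * \<tau> powr (1 - \<beta>) / (1 - \<beta>) \<le> 1 / 2"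
    and R_linear: "linear (R s)"
    and R_cont: "continuous_on {0<..\<tau>} (\<lambda>s. R s x)"
    and R_integrable: "(\<lambda>s. norm (R s x)) integrable_on {0..\<tau>}"
    and R_integral: "integral {0..\<tau>} (\<lambda>s. norm (R s x)) \<le> q * norm x"
    and R_smoothing: "\<lbrakk>0 < \<sigma>; \<sigma> < s; s \<le> \<tau>\<rbrakk> \<Longrightarrow>
      \<exists>w. j w = R s x \<and> norm w \<le> C * C * (s - \<sigma>) powr (- \<beta>) * \<sigma> powr (- \<alpha>) * norm x"
    and R_V: "\<lbrakk>0 < s; s \<le> \<tau>\<rbrakk> \<Longrightarrow> \<exists>w. j w = R s (j u) \<and> norm w \<le> C * s powr (- \<beta>) * norm u"
    and V_linear: "linear (V t)"
    and V_cont: "continuous_on {0<..\<tau>} (\<lambda>t. V t x)"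
    and V_smoothing: "\<lbrakk>0 < t; t \<le> \<tau>\<rbrakk> \<Longrightarrow> norm (V t x) \<le> C * t powr (- \<alpha>) * norm x"
    and V_V: "\<lbrakk>0 < t; t \<le> \<tau>\<rbrakk> \<Longrightarrow> norm (V t (j w)) \<le> C * norm w"
begin

text \<open>
  For \<open>t \<le> 0\<close> the integral defining a Dyson term is over a null interval, so linearity holds
  for all \<open>t \<le> \<tau>\<close>; this spares a case distinction at the end point \<open>s = t\<close>.
\<close>

definition bounds :: "real \<Rightarrow> real \<Rightarrow> (real \<Rightarrow> 'a \<Rightarrow> 'v) \<Rightarrow> bool" where
  "bounds m k U \<longleftrightarrow> 0 \<le> m \<and> 0 \<le> k \<and>
     (\<forall>t\<le>\<tau>. linear (U t)) \<and> (\<forall>x. continuous_on {0<..\<tau>} (\<lambda>t. U t x)) \<and>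
     (\<forall>t\<in>{0<..\<tau>}. \<forall>x. norm (U t x) \<le> m * t powr (- \<alpha>) * norm x) \<and>
     (\<forall>t\<in>{0<..\<tau>}. \<forall>w. norm (U t (j w)) \<le> k * norm w)"

lemma boundsD:
  assumes "bounds m k U"
  shows "0 \<le> m" "0 \<le> k" "t \<le> \<tau> \<Longrightarrow> linear (U t)" "continuous_on {0<..\<tau>} (\<lambda>t. U t x)"
    and "\<lbrakk>0 < t; t \<le> \<tau>\<rbrakk> \<Longrightarrow> norm (U t x) \<le> m * t powr (- \<alpha>) * norm x"
    and "\<lbrakk>0 < t; t \<le> \<tau>\<rbrakk> \<Longrightarrow> norm (U t (j w)) \<le> k * norm w"
  using assms by (auto simp: bounds_def)

text \<open>Joint continuity as for semigroups, now with values in the smaller space. The singular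
  smoothing bound is uniform once times stay above \<open>p / 2\<close>.\<close>

lemma bounds_tendsto:
  assumes U: "bounds m k U" and f: "(f \<longlongrightarrow> p) F" "\<forall>\<^sub>F h in F. f h \<in> {0<..\<tau>}"
    and p: "0 < p" "p \<le> \<tau>" and y: "(y \<longlongrightarrow> y\<^sub>0) F"
  shows "((\<lambda>h. U (f h) (y h)) \<longlongrightarrow> U p y\<^sub>0) F"
proof -
  have "\<forall>\<^sub>F h in F. p / 2 < f h" using p by (intro order_tendstoD[OF f(1)]) auto
  then have "\<forall>\<^sub>F h in F. norm (U (f h) (y h - y\<^sub>0)) \<le> norm (y h - y\<^sub>0) * (m * (p / 2) powr (- \<alpha>))"
    using f(2)
  proof eventually_elim
    case (elim h)
    then have "norm (U (f h) (y h - y\<^sub>0)) \<le> m * f h powr (- \<alpha>) * norm (y h - y\<^sub>0)"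
      by (intro boundsD[OF U]) auto
    also have "\<dots> \<le> m * (p / 2) powr (- \<alpha>) * norm (y h - y\<^sub>0)"
      using elim p \<alpha> boundsD(1)[OF U] by (intro mult_right_mono mult_left_mono powr_mono2') auto
    finally show ?case by (simp add: mult_ac)
  qed
  moreover have "((\<lambda>h. y h - y\<^sub>0) \<longlongrightarrow> 0) F" using y by (simp add: Lim_null[symmetric])
  ultimately have "((\<lambda>h. U (f h) (y h - y\<^sub>0)) \<longlongrightarrow> 0) F"
    by (rule tendsto_0_le[rotated])
  moreover have "((\<lambda>h. U (f h) y\<^sub>0) \<longlongrightarrow> U p y\<^sub>0) F"
    using f(2) p by (intro continuous_on_tendsto_compose[OF boundsD(4)[OF U] f(1)]) auto
  ultimately have "((\<lambda>h. U (f h) (y h - y\<^sub>0) + U (f h) y\<^sub>0) \<longlongrightarrow> 0 + U p y\<^sub>0) F"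
    by (rule tendsto_add)
  moreover have "\<forall>\<^sub>F h in F. U (f h) (y h - y\<^sub>0) + U (f h) y\<^sub>0 = U (f h) (y h)"
    using f(2) by eventually_elim (simp add: linear_diff[OF boundsD(3)[OF U]])
  ultimately show ?thesis by (simp add: Lim_transform_eventually)
qed

section \<open>Splitting and domination of the Volterra integrand\<close>

definition \<mu> :: real where "\<mu> = q powr (1 / (2 * \<alpha>))"

lemma \<mu>: "0 < \<mu>" "\<mu> < 1" "q * \<mu> powr (- \<alpha>) = sqrt q"
proof -
  show "0 < \<mu>" using q by (simp add: \<mu>_def)
  show "\<mu> < 1" using q \<alpha> powr_less_mono2[of "1 / (2 * \<alpha>)" q 1] by (simp add: \<mu>_def)
  have "\<mu> powr (- \<alpha>) = q powr (- (1 / 2))" using \<alpha> by (simp add: \<mu>_def powr_powr)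
  then have "q * \<mu> powr (- \<alpha>) = q powr 1 * q powr (- (1 / 2))" using q by simp
  also have "\<dots> = q powr (1 / 2)" by (subst powr_add[symmetric]) simp
  finally show "q * \<mu> powr (- \<alpha>) = sqrt q" using q by (simp add: powr_half_sqrt)
qed

text \<open>The first summand serves for \<open>s \<le> (1 - \<mu>) * t\<close>, the second for
  later \<open>s\<close>. Their sum dominates on the whole interval, which avoids a piecewise
  function.\<close>

definition majorant :: "real \<Rightarrow> real \<Rightarrow> real \<Rightarrow> 'a \<Rightarrow> real \<Rightarrow> real" where
  "majorant m k t x s = m * (\<mu> * t) powr (- \<alpha>) * norm (R s x) +
     k * (C * C * ((1 - \<mu>) * t / 2) powr (- \<alpha> - \<beta>)) * norm x"

lemma norm_integrand_le:
  assumes U: "bounds m k U" and t: "0 < t" "t \<le> \<tau>" and s: "0 < s" "s < t"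
  shows "norm (U (t - s) (R s x)) \<le> majorant m k t x s"
proof (cases "s \<le> (1 - \<mu>) * t")
  case True
  then have "\<mu> * t \<le> t - s" by (simp add: algebra_simps)
  have "norm (U (t - s) (R s x)) \<le> m * (t - s) powr (- \<alpha>) * norm (R s x)"
    using s t by (intro boundsD[OF U]) auto
  also have "\<dots> \<le> m * (\<mu> * t) powr (- \<alpha>) * norm (R s x)"
    using \<open>\<mu> * t \<le> t - s\<close> \<alpha> t \<mu> boundsD[OF U] by (intro mult_right_mono mult_left_mono powr_mono2') auto
  also have "\<dots> \<le> majorant m k t x s"
    using boundsD[OF U] C by (simp add: majorant_def)
  finally show ?thesis .
next
  case False
  \<comment> \<open>Half the splitting point: then \<open>s - \<sigma> \<ge> \<sigma>\<close>, so
    both negative powers in \<open>R_smoothing\<close> are controlled by powers of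
    \<open>\<sigma>\<close>.\<close>
  define \<sigma> where "\<sigma> = (1 - \<mu>) * t / 2"
  have \<sigma>: "0 < \<sigma>" "\<sigma> \<le> s - \<sigma>" using \<mu> t False by (auto simp: \<sigma>_def mult.commute)
  obtain w where w: "j w = R s x" "norm w \<le> C * C * (s - \<sigma>) powr (- \<beta>) * \<sigma> powr (- \<alpha>) * norm x"
    using R_smoothing[of \<sigma> s x] \<sigma> s t by auto
  have "norm (U (t - s) (R s x)) \<le> k * norm w"
    using s t unfolding w(1)[symmetric] by (intro boundsD[OF U]) auto
  also have "\<dots> \<le> k * (C * C * (s - \<sigma>) powr (- \<beta>) * \<sigma> powr (- \<alpha>) * norm x)"
    using w(2) boundsD[OF U] by (intro mult_left_mono) auto
  also have "\<dots> \<le> k * (C * C * \<sigma> powr (- \<beta>) * \<sigma> powr (- \<alpha>) * norm x)"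
    using \<sigma> \<beta> C boundsD[OF U] by (intro mult_left_mono mult_right_mono powr_mono2') auto
  also have "\<dots> = k * (C * C * \<sigma> powr (- \<alpha> - \<beta>)) * norm x"
    using powr_add[of \<sigma> "- \<beta>" "- \<alpha>"] by (simp add: mult.assoc add.commute)
  also have "\<dots> \<le> majorant m k t x s"
    using boundsD[OF U] by (simp add: majorant_def \<sigma>_def)
  finally show ?thesis .
qed

lemma R_norm_integrable: "0 \<le> a \<Longrightarrow> b \<le> \<tau> \<Longrightarrow> (\<lambda>s. norm (R s x)) integrable_on {a..b}"
  by (rule integrable_on_subinterval[OF R_integrable]) auto

lemma R_norm_integral:
  assumes "0 \<le> t" "t \<le> \<tau>"
  shows "integral {0..t} (\<lambda>s. norm (R s x)) \<le> q * norm x"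
  using assms R_integral[of x] integral_subset_le[of "{0..t}" "{0..\<tau>}" "\<lambda>s. norm (R s x)"]
    R_norm_integrable[of 0 _ x] by force

lemma majorant_integrable: "0 \<le> a \<Longrightarrow> b \<le> \<tau> \<Longrightarrow> majorant m k t x integrable_on {a..b}"
  unfolding majorant_def[abs_def]
  by (intro integrable_add integrable_on_mult_right R_norm_integrable integrable_const_ivl)

text \<open>Joint continuity in \<open>(t, s)\<close> is what the theorem on parameter-dependent
  integrals needs; a slice \<open>Pair t\<close> gives continuity in \<open>s\<close> alone.\<close>

lemma integrand_continuous:
  assumes U: "bounds m k U" and "I \<subseteq> {(t, s). 0 < s \<and> s < t \<and> t \<le> \<tau>}"
  shows "continuous_on I (\<lambda>(t, s). U (t - s) (R s x))"
  unfolding continuous_on_def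
proof (intro ballI)
  fix p assume p: "p \<in> I"
  have I: "0 < snd p" "snd p < fst p" "fst p \<le> \<tau>" if "p \<in> I" for p
    using that assms(2) by auto
  have ev: "\<forall>\<^sub>F p in at p within I. p \<in> I"
    by (simp add: eventually_at_filter)
  have "((\<lambda>p. U (fst p - snd p) (R (snd p) x)) \<longlongrightarrow> U (fst p - snd p) (R (snd p) x)) (at p within I)"
  proof (rule bounds_tendsto[OF U])
    show "((\<lambda>p. fst p - snd p) \<longlongrightarrow> fst p - snd p) (at p within I)" by (intro tendsto_intros)
    show "\<forall>\<^sub>F p in at p within I. fst p - snd p \<in> {0<..\<tau>}"
      using ev by eventually_elim (use I in force)
    show "0 < fst p - snd p" "fst p - snd p \<le> \<tau>" using I[OF p] by auto
    have "(snd \<longlongrightarrow> snd p) (at p within I)" by (intro tendsto_intros)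
    then show "((\<lambda>p. R (snd p) x) \<longlongrightarrow> R (snd p) x) (at p within I)"
    proof (rule continuous_on_tendsto_compose[OF R_cont])
      show "snd p \<in> {0<..\<tau>}" using I[OF p] by auto
      show "\<forall>\<^sub>F p in at p within I. snd p \<in> {0<..\<tau>}"
        using ev by eventually_elim (use I in force)
    qed
  qed
  then show "((\<lambda>(t, s). U (t - s) (R s x)) \<longlongrightarrow> (case p of (t, s) \<Rightarrow> U (t - s) (R s x))) (at p within I)"
    by (simp add: case_prod_unfold)
qed

lemma integrand_integrable:
  assumes U: "bounds m k U" and t: "0 < t" "t \<le> \<tau>"
  shows "(\<lambda>s. U (t - s) (R s x)) integrable_on {0..t}"
proof (rule integrable_on_dominated)
  have "continuous_on {0<..<t} ((\<lambda>(t, s). U (t - s) (R s x)) \<circ> Pair t)"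
    using t by (intro continuous_on_compose integrand_continuous[OF U] continuous_intros) auto
  then show "continuous_on {0<..<t} (\<lambda>s. U (t - s) (R s x))" by (simp add: o_def)
  show "norm (U (t - s) (R s x)) \<le> majorant m k t x s" if "0 < s" "s < t" for s
    by (rule norm_integrand_le[OF U t that])
qed (use t in \<open>auto intro: majorant_integrable\<close>)

section \<open>One Volterra step: continuity and the two norm bounds\<close>

definition convolution :: "(real \<Rightarrow> 'a \<Rightarrow> 'v) \<Rightarrow> real \<Rightarrow> 'a \<Rightarrow> 'v" where
  "convolution U t x = integral {0..t} (\<lambda>s. U (t - s) (R s x))"

lemma convolution_linear:
  assumes U: "bounds m k U" and "t \<le> \<tau>"
  shows "linear (convolution U t)"
proof (cases "0 < t")
  case True
  note int = integrand_integrable[OF U True \<open>t \<le> \<tau>\<close>]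
  have lin: "linear (\<lambda>x. U (t - s) (R s x))" if "s \<in> {0..t}" for s
    using linear_compose[OF R_linear[of s] boundsD(3)[OF U, of "t - s"]] that \<open>t \<le> \<tau>\<close> by (simp add: o_def)
  show ?thesis
  proof (rule linearI)
    fix x y and c :: real
    have "convolution U t (x + y) = integral {0..t} (\<lambda>s. U (t - s) (R s x) + U (t - s) (R s y))"
      unfolding convolution_def by (intro integral_cong linear_add[OF lin])
    then show "convolution U t (x + y) = convolution U t x + convolution U t y"
      by (simp add: convolution_def integral_add int)
    have "convolution U t (c *\<^sub>R x) = integral {0..t} (\<lambda>s. c *\<^sub>R U (t - s) (R s x))"
      unfolding convolution_def by (intro integral_cong linear_scale[OF lin])
    then show "convolution U t (c *\<^sub>R x) = c *\<^sub>R convolution U t x" by (simp add: convolution_def)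
  qed
next
  case False
  then have "convolution U t x = 0" for x by (cases "t = 0") (auto simp: convolution_def)
  then show ?thesis by (auto intro: linearI)
qed

text \<open>The middle piece \<open>H\<close> stays away from both singular ends and is a continuous
  parameter integral. The two end pieces are small uniformly in \<open>t'\<close>, being bounded by
  increments of the antiderivative \<open>G\<close> of a single majorant. With two end pieces at
  each of the two times, the errors add up to five times \<open>\<epsilon> / 5\<close>.\<close>

lemma convolution_continuous:
  assumes U: "bounds m k U"
  shows "continuous_on {0<..\<tau>} (\<lambda>t. convolution U t x)"
  unfolding continuous_on_iff
proof (intro ballI allI impI)
  fix t \<epsilon> :: real assume "t \<in> {0<..\<tau>}" and "0 < \<epsilon>"
  then have t: "0 < t" "t \<le> \<tau>" by auto
  \<comment> \<open>The majorant decreases in its time parameter, so its value at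
    \<open>t / 2\<close> serves for all \<open>t' \<ge> t / 2\<close>.\<close>
  define g where "g = majorant m k (t / 2) x"
  define G where "G u = integral {0..u} g" for u
  have g_int: "g integrable_on {a..b}" if "0 \<le> a" "b \<le> \<tau>" for a b
    unfolding g_def by (rule majorant_integrable[OF that])
  have G_diff: "G b - G a = integral {a..b} g" if "0 \<le> a" "a \<le> b" "b \<le> \<tau>" for a b
    using Henstock_Kurzweil_Integration.integral_combine[OF that(1,2) g_int[OF order_refl that(3)]]
    by (simp add: G_def algebra_simps)
  have U_le_g: "norm (U (t' - s) (R s x)) \<le> g s" if "t / 2 \<le> t'" "t' \<le> \<tau>" "0 < s" "s < t'" for t' s
  proof -
    have "norm (U (t' - s) (R s x)) \<le> majorant m k t' x s"
      using that t by (intro norm_integrand_le[OF U]) auto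
    also have "\<dots> \<le> g s"
      using that t \<mu> \<alpha> \<beta> C boundsD[OF U] unfolding g_def majorant_def
      by (intro add_mono mult_right_mono mult_left_mono powr_mono2' divide_right_mono) auto
    finally show ?thesis .
  qed
  have "uniformly_continuous_on {0..\<tau>} G"
    unfolding G_def
    by (intro compact_uniformly_continuous indefinite_integral_continuous_1 g_int) auto
  then obtain \<delta> where "\<delta> > 0"
    and \<delta>: "\<And>a b. \<lbrakk>0 \<le> a; a \<le> \<tau>; 0 \<le> b; b \<le> \<tau>; \<bar>b - a\<bar> < \<delta>\<rbrakk> \<Longrightarrow> \<bar>G b - G a\<bar> < \<epsilon> / 5"
    unfolding uniformly_continuous_on_def dist_real_def using \<open>0 < \<epsilon>\<close>
    by (metis atLeastAtMost_iff zero_less_divide_iff zero_less_numeral)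
  \<comment> \<open>For \<open>t'\<close> within \<open>e / 2\<close> of \<open>t\<close>, the last
    piece \<open>{t - e..t'}\<close> is shorter than \<open>3 * e / 2 < \<delta>\<close>, and
    \<open>t - e < t'\<close> keeps the middle piece off the singularity at
    \<open>s = t'\<close>.\<close>
  define e where "e = min (\<delta> / 2) (t / 4)"
  have e: "0 < e" "e \<le> t / 4" "3 * e / 2 < \<delta>" using t \<open>\<delta> > 0\<close> by (auto simp: e_def)
  define W where "W = {0<..\<tau>} \<inter> {t - e / 2<..<t + e / 2}"
  define H where "H t' = integral {e..t - e} (\<lambda>s. U (t' - s) (R s x))" for t'
  have near: "dist (convolution U t' x) (H t') < 2 * (\<epsilon> / 5)" if t': "t' \<in> W" for t'
  proof -
    have t'_bounds: "t / 2 \<le> t'" "t' \<le> \<tau>" "0 < t'" "t - e < t'" "t' < t + e / 2"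
      using t' e by (auto simp: W_def)
    have int: "(\<lambda>s. U (t' - s) (R s x)) integrable_on {a..b}" if "0 \<le> a" "b \<le> t'" for a b
      by (rule integrable_on_subinterval[OF integrand_integrable[OF U]]) (use t'_bounds that in auto)
    have le_G: "norm (integral {a..b} (\<lambda>s. U (t' - s) (R s x))) \<le> G b - G a"
      if "0 \<le> a" "a \<le> b" "b \<le> t'" for a b
      using that t'_bounds by (auto simp: G_diff intro!: integral_norm_bound_interior int g_int U_le_g)
    have "convolution U t' x = integral {0..e} (\<lambda>s. U (t' - s) (R s x)) + H t' +
        integral {t - e..t'} (\<lambda>s. U (t' - s) (R s x))"
      using e t t'_bounds int unfolding convolution_def H_def
      by (simp add: Henstock_Kurzweil_Integration.integral_combine)
    moreover have "norm (integral {0..e} (\<lambda>s. U (t' - s) (R s x))) < \<epsilon> / 5"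
    proof -
      have "norm (integral {0..e} (\<lambda>s. U (t' - s) (R s x))) \<le> G e - G 0"
        using e t t'_bounds by (intro le_G) auto
      moreover have "\<bar>G e - G 0\<bar> < \<epsilon> / 5" using e t by (intro \<delta>) auto
      ultimately show ?thesis by linarith
    qed
    moreover have "norm (integral {t - e..t'} (\<lambda>s. U (t' - s) (R s x))) < \<epsilon> / 5"
    proof -
      have "norm (integral {t - e..t'} (\<lambda>s. U (t' - s) (R s x))) \<le> G t' - G (t - e)"
        using e t t'_bounds by (intro le_G) auto
      moreover have "\<bar>G t' - G (t - e)\<bar> < \<epsilon> / 5" using e t t'_bounds by (intro \<delta>) auto
      ultimately show ?thesis by linarith
    qed
    ultimately show ?thesis
      using norm_triangle_ineq[of "integral {0..e} (\<lambda>s. U (t' - s) (R s x))"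
          "integral {t - e..t'} (\<lambda>s. U (t' - s) (R s x))"]
      by (simp add: dist_norm)
  qed
  have "continuous_on W (\<lambda>t'. integral (cbox e (t - e)) (\<lambda>s. U (t' - s) (R s x)))"
    by (intro integral_continuous_on_param integrand_continuous[OF U]) (use e in \<open>auto simp: W_def\<close>)
  then have "continuous_on W H" by (simp add: H_def)
  moreover have "t \<in> W" using t e by (auto simp: W_def)
  ultimately obtain d where d: "d > 0" "\<And>t'. t' \<in> W \<Longrightarrow> dist t' t < d \<Longrightarrow> dist (H t') (H t) < \<epsilon> / 5"
    unfolding continuous_on_iff using \<open>0 < \<epsilon>\<close> by (metis zero_less_divide_iff zero_less_numeral)
  have "dist (convolution U t' x) (convolution U t x) < \<epsilon>"
    if "t' \<in> {0<..\<tau>}" "dist t' t < min d (e / 2)" for t'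
  proof -
    have "\<bar>t' - t\<bar> < e / 2" using that by (simp add: dist_real_def)
    then have "t' \<in> W" using that(1) unfolding W_def abs_less_iff by auto
    then show ?thesis
      using near[of t'] near[OF \<open>t \<in> W\<close>] d(2)[of t'] that
        dist_triangle[of "convolution U t' x" "convolution U t x" "H t'"]
        dist_triangle[of "H t'" "convolution U t x" "H t"]
      by (simp add: dist_commute)
  qed
  then show "\<exists>d>0. \<forall>t'\<in>{0<..\<tau>}. dist t' t < d \<longrightarrow>
      dist (convolution U t' x) (convolution U t x) < \<epsilon>"
    using d(1) e(1) by (intro exI[of _ "min d (e / 2)"]) auto
qed

text \<open>The constant left over from the second summand of \<open>majorant\<close> when the power
  of \<open>t\<close> is pulled out.\<close>

definition \<kappa> :: real where "\<kappa> = C * C * ((1 - \<mu>) / 2) powr (- \<alpha> - \<beta>)"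

lemma convolution_smoothing:
  assumes U: "bounds m k U" and t: "0 < t" "t \<le> \<tau>"
  shows "norm (convolution U t x) \<le> (sqrt q * m + \<kappa> * k) * t powr (- \<alpha>) * norm x"
proof -
  have "norm (convolution U t x) \<le> integral {0..t} (majorant m k t x)"
    unfolding convolution_def using t
    by (intro integral_norm_bound_interior integrand_integrable[OF U] majorant_integrable
        norm_integrand_le[OF U]) auto
  also have "\<dots> = m * (\<mu> * t) powr (- \<alpha>) * integral {0..t} (\<lambda>s. norm (R s x)) +
      k * (C * C * ((1 - \<mu>) * t / 2) powr (- \<alpha> - \<beta>)) * norm x * t"
    unfolding majorant_def using t
    by (subst integral_add) (auto intro: integrable_on_mult_right R_norm_integrable)
  also have "\<dots> \<le> m * (\<mu> * t) powr (- \<alpha>) * (q * norm x) +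
      k * (C * C * ((1 - \<mu>) * t / 2) powr (- \<alpha> - \<beta>)) * norm x * t"
    using t boundsD[OF U] R_norm_integral[of t x] by (intro add_right_mono mult_left_mono) auto
  also have "m * (\<mu> * t) powr (- \<alpha>) * (q * norm x) = sqrt q * m * t powr (- \<alpha>) * norm x"
    using t \<mu> by (simp add: powr_mult flip: \<mu>(3))
  also have "k * (C * C * ((1 - \<mu>) * t / 2) powr (- \<alpha> - \<beta>)) * norm x * t
      = \<kappa> * k * norm x * (t powr (- \<alpha> - \<beta>) * t)"
    using t \<mu> powr_mult[of "(1 - \<mu>) / 2" t "- \<alpha> - \<beta>"] by (simp add: \<kappa>_def)
  \<comment> \<open>The length \<open>t\<close> of the interval compensates the factor
    \<open>t powr (- \<beta>)\<close>: the surplus \<open>t powr (1 - \<beta>)\<close> is at most 1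
    because \<open>\<beta> < 1\<close> and \<open>t \<le> 1\<close>.\<close>
  also have "t powr (- \<alpha> - \<beta>) * t = t powr (- \<alpha>) * t powr (1 - \<beta>)"
    using t powr_add[of t "- \<alpha> - \<beta>" 1] powr_add[of t "- \<alpha>" "1 - \<beta>"]
    by (simp add: algebra_simps)
  also have "\<kappa> * k * norm x * (t powr (- \<alpha>) * t powr (1 - \<beta>)) \<le> \<kappa> * k * norm x * (t powr (- \<alpha>) * 1)"
    using t \<tau> \<beta> boundsD[OF U] C by (intro mult_left_mono powr_le1) (auto simp: \<kappa>_def)
  finally show ?thesis by (simp add: algebra_simps)
qed

text \<open>On the smaller space \<open>R s\<close> has only the integrable singularity
  \<open>s powr (- \<beta>)\<close>, and by \<open>\<tau>_small\<close> its integral contributes at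
  most the factor 1/2.\<close>

lemma convolution_V:
  assumes U: "bounds m k U" and t: "0 < t" "t \<le> \<tau>"
  shows "norm (convolution U t (j w)) \<le> k / 2 * norm w"
proof -
  have powr_int: "((\<lambda>s. s powr (- \<beta>)) has_integral t powr (- \<beta> + 1) / (- \<beta> + 1)) {0..t}"
    using t \<beta> by (intro has_integral_powr_from_0) auto
  have "norm (U (t - s) (R s (j w))) \<le> k * C * norm w * s powr (- \<beta>)" if s: "0 < s" "s < t" for s
  proof -
    obtain u where u: "j u = R s (j w)" "norm u \<le> C * s powr (- \<beta>) * norm w"
      using R_V[of s w] s t by auto
    have "norm (U (t - s) (R s (j w))) \<le> k * norm u"
      using s t unfolding u(1)[symmetric] by (intro boundsD[OF U]) auto
    also have "\<dots> \<le> k * (C * s powr (- \<beta>) * norm w)"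
      using u(2) boundsD[OF U] by (intro mult_left_mono) auto
    finally show ?thesis by (simp add: mult_ac)
  qed
  then have "norm (convolution U t (j w)) \<le> integral {0..t} (\<lambda>s. k * C * norm w * s powr (- \<beta>))"
    unfolding convolution_def using t has_integral_integrable[OF powr_int]
    by (intro integral_norm_bound_interior integrand_integrable[OF U] integrable_on_mult_right) auto
  also have "\<dots> = k * norm w * (C * t powr (1 - \<beta>) / (1 - \<beta>))"
    using integral_unique[OF powr_int] by simp
  also have "\<dots> \<le> k * norm w * (C * \<tau> powr (1 - \<beta>) / (1 - \<beta>))"
    using t \<beta> C boundsD[OF U] by (intro mult_left_mono divide_right_mono powr_mono2) auto
  also have "\<dots> \<le> k * norm w * (1 / 2)"
    using \<tau>_small boundsD[OF U] by (intro mult_left_mono) auto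
  finally show ?thesis by simp
qed

lemma bounds_convolution:
  assumes U: "bounds m k U"
  shows "bounds (sqrt q * m + \<kappa> * k) (k / 2) (convolution U)"
  using convolution_linear[OF U] convolution_continuous[OF U] convolution_smoothing[OF U]
    convolution_V[OF U] boundsD[OF U] q C
  unfolding bounds_def \<kappa>_def by (intro conjI) auto

lemma bounds_mono:
  assumes U: "bounds m k U" and "m \<le> m'" "k \<le> k'"
  shows "bounds m' k' U"
proof -
  have "norm (U t x) \<le> m' * t powr (- \<alpha>) * norm x" if "t \<in> {0<..\<tau>}" for t x
    by (rule order_trans[OF boundsD(5)[OF U]]) (use that assms(2) in \<open>auto intro!: mult_right_mono\<close>)
  moreover have "norm (U t (j w)) \<le> k' * norm w" if "t \<in> {0<..\<tau>}" for t w
    by (rule order_trans[OF boundsD(6)[OF U]]) (use that assms(3) in \<open>auto intro!: mult_right_mono\<close>)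
  ultimately show ?thesis using U assms(2,3) by (auto simp: bounds_def)
qed

section \<open>Geometric convergence of the Dyson series and its sum\<close>

primrec dyson :: "nat \<Rightarrow> real \<Rightarrow> 'a \<Rightarrow> 'v" where
  "dyson 0 = V"
| "dyson (Suc n) = convolution (dyson n)"

text \<open>The recursion for the pair of bounds is triangular with diagonal entries
  \<open>sqrt q\<close> and 1/2. Any \<open>r < 1\<close> above both is a common geometric rate,
  provided \<open>M\<close> is large enough to absorb the coupling through
  \<open>\<kappa>\<close>.\<close>

lemma dyson_bounds: "\<exists>M r. 0 < M \<and> 0 < r \<and> r < 1 \<and> (\<forall>n. bounds (M * r ^ n) (C * r ^ n) (dyson n))"
proof -
  have "sqrt q < 1" using q by simp
  then obtain r where r: "max (sqrt q) (1 / 2) < r" "r < 1" using dense[of "max (sqrt q) (1 / 2)" 1] by auto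
  then have r': "sqrt q < r" "1 / 2 < r" "0 < r" by auto
  \<comment> \<open>The first entry covers \<open>n = 0\<close>; the second gives
    \<open>sqrt q * M + \<kappa> * C \<le> r * M\<close>, the induction step without the factor
    \<open>r ^ n\<close>.\<close>
  define M where "M = max C (\<kappa> * C / (r - sqrt q))"
  have M: "C \<le> M" "\<kappa> * C \<le> (r - sqrt q) * M"
    using r' by (auto simp: M_def max_def field_simps)
  have "bounds (M * r ^ n) (C * r ^ n) (dyson n)" for n
  proof (induction n)
    case 0
    have "bounds C C V" unfolding bounds_def using C V_linear V_cont V_smoothing V_V by auto
    then show ?case using M by (auto intro: bounds_mono)
  next
    case (Suc n)
    have "sqrt q * (M * r ^ n) + \<kappa> * (C * r ^ n) \<le> sqrt q * (M * r ^ n) + ((r - sqrt q) * M) * r ^ n"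
      using mult_right_mono[OF M(2), of "r ^ n"] r' by (simp add: mult.assoc)
    also have "\<dots> = M * r ^ Suc n" by (simp add: algebra_simps)
    finally have "sqrt q * (M * r ^ n) + \<kappa> * (C * r ^ n) \<le> M * r ^ Suc n" .
    moreover have "C * r ^ n / 2 \<le> C * r ^ Suc n"
      using mult_right_mono[of "1 / 2" r "C * r ^ n"] r' C by (simp add: mult_ac)
    ultimately show ?case by (auto intro: bounds_mono[OF bounds_convolution[OF Suc]])
  qed
  then show ?thesis using M C r r' by (intro exI[of _ M] exI[of _ r]) auto
qed

text \<open>The remainder after \<open>N + 1\<close> terms is the Volterra integral of the remainder
  after \<open>N\<close> terms, and each integration against \<open>R\<close> gains a factor
  \<open>q\<close>. This is an estimate in the norm of X, the only one in which \<open>S\<close> is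
  known to be bounded beforehand.\<close>

lemma dyson_remainder:
  assumes S_bound: "\<And>t x. \<lbrakk>0 \<le> t; t \<le> \<tau>\<rbrakk> \<Longrightarrow> norm (S t x) \<le> L * norm x" and "0 \<le> L"
    and S_eq: "\<And>t x. \<lbrakk>0 < t; t \<le> \<tau>\<rbrakk> \<Longrightarrow>
      ((\<lambda>s. S (t - s) (R s x)) has_integral S t x - j (V t x)) {0..t}"
    and t: "0 < t" "t \<le> \<tau>"
  shows "norm (S t x - j (\<Sum>n<N. dyson n t x)) \<le> L * q ^ N * norm x"
  using t
proof (induction N arbitrary: t x)
  case 0
  then show ?case using S_bound[of t x] by (simp add: linear_0[OF bounded_linear.linear[OF j]])
next
  case (Suc N)
  let ?f = "\<lambda>s. S (t - s) (R s x) - (\<Sum>n<N. j (dyson n (t - s) (R s x)))"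
  have j_sum: "j (sum f I) = (\<Sum>n\<in>I. j (f n))" for f :: "nat \<Rightarrow> 'v" and I
    by (rule linear_sum[OF bounded_linear.linear[OF j]])
  have "((\<lambda>s. j (dyson n (t - s) (R s x))) has_integral j (dyson (Suc n) t x)) {0..t}" for n
  proof -
    obtain m k where "bounds m k (dyson n)" using dyson_bounds by blast
    from has_integral_linear[OF integrable_integral[OF integrand_integrable[OF this Suc.prems]] j]
    show ?thesis by (simp add: o_def convolution_def)
  qed
  then have "(?f has_integral S t x - j (V t x) - (\<Sum>n<N. j (dyson (Suc n) t x))) {0..t}"
    by (intro has_integral_diff S_eq has_integral_sum Suc.prems) auto
  \<comment> \<open>Index shift: the integrals produce the terms from 1 to \<open>N\<close>, and the
    free term \<open>V t x\<close> is term 0.\<close>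
  moreover have "(\<Sum>n<Suc N. dyson n t x) = V t x + (\<Sum>n<N. dyson (Suc n) t x)"
    by (simp add: sum.lessThan_Suc_shift del: sum.lessThan_Suc)
  then have "S t x - j (\<Sum>n<Suc N. dyson n t x) = S t x - j (V t x) - (\<Sum>n<N. j (dyson (Suc n) t x))"
    by (simp only: linear_add[OF bounded_linear.linear[OF j]] j_sum diff_diff_add)
  ultimately have f: "(?f has_integral S t x - j (\<Sum>n<Suc N. dyson n t x)) {0..t}"
    by (simp only:)
  have "norm (integral {0..t} ?f) \<le> integral {0..t} (\<lambda>s. L * q ^ N * norm (R s x))"
  proof (rule integral_norm_bound_interior)
    show "norm (?f s) \<le> L * q ^ N * norm (R s x)" if "0 < s" "s < t" for s
      using Suc.IH[of "t - s" "R s x"] that Suc.prems by (simp add: j_sum)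
  qed (use f Suc.prems in \<open>auto intro: integrable_on_mult_right R_norm_integrable\<close>)
  also have "\<dots> = L * q ^ N * integral {0..t} (\<lambda>s. norm (R s x))" by simp
  also have "\<dots> \<le> L * q ^ N * (q * norm x)"
    using R_norm_integral[of t x] Suc.prems \<open>0 \<le> L\<close> q by (intro mult_left_mono) auto
  finally show ?case using integral_unique[OF f] by (simp add: mult_ac)
qed

text \<open>The Dyson series converges absolutely in the smaller space. Its image under
  \<open>j\<close> is \<open>S t x\<close>, because the remainders tend to 0 in X and limits there
  are unique.\<close>

lemma volterra_solution_smoothing:
  assumes S_bound: "\<And>t x. \<lbrakk>0 \<le> t; t \<le> \<tau>\<rbrakk> \<Longrightarrow> norm (S t x) \<le> L * norm x" and "0 \<le> L"
    and S_eq: "\<And>t x. \<lbrakk>0 < t; t \<le> \<tau>\<rbrakk> \<Longrightarrow>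
      ((\<lambda>s. S (t - s) (R s x)) has_integral S t x - j (V t x)) {0..t}"
  shows "\<exists>M>0. \<forall>t\<in>{0<..\<tau>}. \<forall>x. \<exists>v. j v = S t x \<and> norm v \<le> M * t powr (- \<alpha>) * norm x"
proof -
  obtain M r where M: "0 < M" "0 < r" "r < 1" and "\<And>n. bounds (M * r ^ n) (C * r ^ n) (dyson n)"
    using dyson_bounds by blast
  note dyson_le = boundsD(5)[OF this(4)]
  have "\<exists>v. j v = S t x \<and> norm v \<le> M / (1 - r) * t powr (- \<alpha>) * norm x" if t: "0 < t" "t \<le> \<tau>" for t x
  proof (intro exI conjI)
    let ?b = "\<lambda>n. M * r ^ n * t powr (- \<alpha>) * norm x"
    have "(\<lambda>n. M * t powr (- \<alpha>) * norm x * r ^ n) sums (M * t powr (- \<alpha>) * norm x * (1 / (1 - r)))"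
      using M by (intro sums_mult geometric_sums) auto
    then have b: "?b sums (M / (1 - r) * t powr (- \<alpha>) * norm x)" by (simp add: mult_ac)
    have le: "norm (dyson n t x) \<le> ?b n" for n using dyson_le[OF t] by simp
    show "norm (\<Sum>n. dyson n t x) \<le> M / (1 - r) * t powr (- \<alpha>) * norm x"
      using norm_suminf_le[OF le sums_summable[OF b]] sums_unique[OF b] by simp
    have "summable (\<lambda>n. dyson n t x)" by (rule summable_comparison_test'[OF sums_summable[OF b] le])
    then have "(\<lambda>N. j (\<Sum>n<N. dyson n t x)) \<longlonglongrightarrow> j (\<Sum>n. dyson n t x)"
      by (intro bounded_linear.tendsto[OF j] summable_LIMSEQ)
    moreover have "(\<lambda>N. S t x - j (\<Sum>n<N. dyson n t x)) \<longlonglongrightarrow> 0"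
    proof (rule Lim_null_comparison)
      show "\<forall>\<^sub>F N in sequentially. norm (S t x - j (\<Sum>n<N. dyson n t x)) \<le> L * q ^ N * norm x"
        using dyson_remainder[OF assms t] by simp
      have "(\<lambda>N. L * q ^ N * norm x) \<longlonglongrightarrow> L * 0 * norm x"
        using q by (intro tendsto_intros LIMSEQ_realpow_zero) auto
      then show "(\<lambda>N. L * q ^ N * norm x) \<longlonglongrightarrow> 0" by simp
    qed
    then have "(\<lambda>N. j (\<Sum>n<N. dyson n t x)) \<longlonglongrightarrow> S t x"
      using tendsto_diff[OF tendsto_const[of "S t x"]] by fastforce
    ultimately show "j (\<Sum>n. dyson n t x) = S t x" by (rule LIMSEQ_unique)
  qed
  then show ?thesis using M by (intro exI[of _ "M / (1 - r)"]) auto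
qed

end

section \<open>The perturbed semigroup\<close>

lemma opnorm_into_leD:
  assumes "inj j" and S: "opnorm_into_le j S c"
  shows "j (inv j (S x)) = S x" "norm (inv j (S x)) \<le> c * norm x" "bounded_linear (\<lambda>x. inv j (S x))"
proof -
  have "S x \<in> range j" using S by (auto simp: opnorm_into_le_def)
  then show "j (inv j (S x)) = S x" by (rule f_inv_into_f)
  show bl: "bounded_linear (\<lambda>x. inv j (S x))" using S by (simp add: opnorm_into_le_def o_def)
  have "norm (inv j (S x)) \<le> onorm (\<lambda>x. inv j (S x)) * norm x" by (rule onorm[OF bl])
  also have "\<dots> \<le> c * norm x"
    using S by (intro mult_right_mono) (auto simp: opnorm_into_le_def o_def)
  finally show "norm (inv j (S x)) \<le> c * norm x" .
qed

text \<open>Injectivity of \<open>j\<close> identifies each pointwise witness with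
  \<open>inv j (S x)\<close>; linearity of \<open>inv j \<circ> S\<close> follows by comparing
  images under \<open>j\<close>.\<close>

lemma opnorm_into_leI:
  assumes j: "linear j" "inj j" and S: "linear S"
    and ex: "\<And>x. \<exists>v. j v = S x \<and> norm v \<le> c * norm x" and "0 \<le> c"
  shows "opnorm_into_le j S c"
proof -
  have inv: "j (inv j (S x)) = S x" "norm (inv j (S x)) \<le> c * norm x" for x
    using ex[of x] inv_f_f[OF j(2)] by (metis, metis)
  have "linear (inv j \<circ> S)"
    by (rule linearI; rule injD[OF j(2)])
      (simp_all only: o_def inv linear_add[OF j(1)] linear_scale[OF j(1)],
        simp_all only: linear_add[OF S] linear_scale[OF S])
  then have "bounded_linear (inv j \<circ> S)"
    unfolding bounded_linear_def bounded_linear_axioms_def using inv(2)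
    by (auto simp: mult.commute)
  moreover have "onorm (inv j \<circ> S) \<le> c" using inv(2) \<open>0 \<le> c\<close> by (intro onorm_bound) auto
  moreover have "range S \<subseteq> range j" using inv(1) by (metis image_subsetI rangeI)
  ultimately show ?thesis by (simp add: opnorm_into_le_def)
qed

theorem theorem2p5:
  fixes T S :: "real \<Rightarrow> 'a::banach \<Rightarrow>\<^sub>L 'a"
    and A B :: "'a \<Rightarrow> 'a" and domA domB :: "'a set"
    and j :: "'v::banach \<Rightarrow> 'a"
    and C \<alpha> \<beta> q t\<^sub>0 :: real
  assumes "c0_semigroup T" and "is_generator T domA A"
    and "continuous_embedding j"
    and "linear_operator domB B" and "domA \<subseteq> domB"
    and "\<exists>K. \<forall>x\<in>domA. norm (B x) \<le> K * graph_norm A x"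
    and "C \<ge> 1" and "\<alpha> > 0" and "0 \<le> \<beta>" and "\<beta> < 1" and "0 < q" and "q < 1" and "t\<^sub>0 > 0"
    and "\<forall>t\<in>{0<..1}. opnorm_into_le j (T t) (C * t powr (- \<alpha>))"
    and "\<forall>x\<in>domA. integral {0..t\<^sub>0} (\<lambda>s. norm (B (T s x))) \<le> q * norm x"
    and "\<forall>t\<in>{0<..1}. opnorm_into_le j (T t \<circ> j) C"
    and "\<forall>v. \<forall>t\<in>{0<..1}. T t (j v) \<in> domB \<longrightarrow>
           B (T t (j v)) \<in> range j \<and> norm (inv j (B (T t (j v)))) \<le> C * t powr (- \<beta>) * norm v"
    and "separable_space (euclidean :: 'v topology) \<or> closed (j ` cball 0 1)"
    and "immediately_differentiable T"
    and "c0_semigroup S" and "is_generator S domA (\<lambda>x. A x + B x)"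
  shows "\<exists>C'>0. \<forall>t\<in>{0<..1}. opnorm_into_le j (S t) (C' * t powr (- \<alpha>))"
proof -
  note T = assms(1) and GT = assms(2) and B = assms(4) and D = assms(5) and C = \<open>C \<ge> 1\<close>
    and \<alpha> = \<open>\<alpha> > 0\<close> and \<beta> = \<open>0 \<le> \<beta>\<close> \<open>\<beta> < 1\<close> and q = \<open>0 < q\<close> \<open>q < 1\<close> and diff = assms(19)
    and S = assms(20) and GS = assms(21)
  have j: "bounded_linear j" "inj j" using assms(3) by (auto simp: continuous_embedding_def)
  obtain K where K: "\<And>x. x \<in> domA \<Longrightarrow> norm (B x) \<le> K * graph_norm A x" using assms(6) by blast
  have dom: "T t x \<in> domB" if "0 < t" for t x
    using immediately_differentiable_generator(1)[OF T GT diff that] D by blast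
  have T_inv: "j (inv j (T t x)) = T t x" "norm (inv j (T t x)) \<le> C * t powr (- \<alpha>) * norm x"
      "bounded_linear (\<lambda>x. inv j (T t x))" if "0 < t" "t \<le> 1" for t x
    by (rule opnorm_into_leD[OF j(2), where c = "C * t powr (- \<alpha>)"], use assms(14) that in simp)+
  have T_V: "norm (inv j (T t (j w))) \<le> C * norm w" if "0 < t" "t \<le> 1" for t w
    using opnorm_into_leD(2)[OF j(2), of "T t \<circ> j" C w] assms(16) that by auto
  have BT_V: "\<exists>w. j w = B (T t (j v)) \<and> norm w \<le> C * t powr (- \<beta>) * norm v"
    if "0 < t" "t \<le> 1" for t v
    using assms(17) dom[OF that(1)] that f_inv_into_f[of "B (T t (j v))" j UNIV]
    by (intro exI[of _ "inv j (B (T t (j v)))"]) auto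

  \<comment> \<open>\<open>t\<^sub>0\<close> keeps the Miyadera bound available, 1 the smoothing
    hypotheses, and the last entry solves
    \<open>C * \<tau> powr (1 - \<beta>) / (1 - \<beta>) = 1 / 2\<close>.\<close>
  define \<tau> where "\<tau> = min (min t\<^sub>0 1) (((1 - \<beta>) / (2 * C)) powr (1 / (1 - \<beta>)))"
  have \<tau>: "0 < \<tau>" "\<tau> \<le> t\<^sub>0" "\<tau> \<le> 1" using \<open>t\<^sub>0 > 0\<close> C \<beta> by (auto simp: \<tau>_def)
  have \<tau>_small: "C * \<tau> powr (1 - \<beta>) / (1 - \<beta>) \<le> 1 / 2"
  proof -
    have "\<tau> powr (1 - \<beta>) \<le> (((1 - \<beta>) / (2 * C)) powr (1 / (1 - \<beta>))) powr (1 - \<beta>)"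
      using \<tau> \<beta> by (intro powr_mono2) (auto simp: \<tau>_def)
    also have "\<dots> = (1 - \<beta>) / (2 * C)" using \<beta> C by (simp add: powr_powr)
    finally show ?thesis using \<beta> C by (simp add: field_simps)
  qed

  \<comment> \<open>The value 0 for \<open>s \<le> 0\<close> makes \<open>R s\<close> linear at
    every \<open>s\<close>: \<open>T 0 x = x\<close> need not lie in \<open>domB\<close>. Integrals
    over \<open>{0..t}\<close> change at one point only. The default in \<open>V\<close> likewise
    makes it linear at every time.\<close>
  define R where "R s x = (if 0 < s then B (T s x) else 0)" for s x
  define V where "V t x = (if 0 < t \<and> t \<le> 1 then inv j (T t x) else 0)" for t x
  interpret volterra: smoothing_volterra j R V C \<alpha> \<beta> q \<tau>
  proof (rule smoothing_volterra.intro)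
    show "linear (R s)" for s
    proof (cases "0 < s")
      case True
      with B dom[OF True] show ?thesis
        by (intro linearI) (auto simp: R_def blinfun.add_right blinfun.scaleR_right linear_operator_def)
    qed (auto simp: R_def intro!: linearI)
    fix x
    show "continuous_on {0<..\<tau>} (\<lambda>s. R s x)"
      using continuous_on_subset[OF perturbed_orbit_continuous[OF T GT diff B D K], of "{0<..\<tau>}"]
      by (rule continuous_on_eq) (auto simp: R_def)
    have orbit: "(\<lambda>s. norm (B (T s x))) integrable_on {0..t\<^sub>0}"
        "integral {0..t\<^sub>0} (\<lambda>s. norm (B (T s x))) \<le> q * norm x"
      using perturbed_orbit_integral[OF T GT diff B D K \<open>t\<^sub>0 > 0\<close>] assms(15) by blast+
    have orbit_\<tau>: "(\<lambda>s. norm (B (T s x))) integrable_on {0..\<tau>}"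
      by (rule integrable_on_subinterval[OF orbit(1)]) (use \<tau> in auto)
    show "(\<lambda>s. norm (R s x)) integrable_on {0..\<tau>}"
      by (rule integrable_spike[OF orbit_\<tau>, of "{0}"]) (auto simp: R_def)
    have "integral {0..\<tau>} (\<lambda>s. norm (R s x)) = integral {0..\<tau>} (\<lambda>s. norm (B (T s x)))"
      by (rule integral_spike[of "{0}"]) (auto simp: R_def)
    also have "\<dots> \<le> integral {0..t\<^sub>0} (\<lambda>s. norm (B (T s x)))"
      using \<tau> by (intro integral_subset_le orbit orbit_\<tau>) auto
    finally show "integral {0..\<tau>} (\<lambda>s. norm (R s x)) \<le> q * norm x" using orbit(2) by simp
    show "\<exists>w. j w = R s x \<and> norm w \<le> C * C * (s - \<sigma>) powr (- \<beta>) * \<sigma> powr (- \<alpha>) * norm x"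
      if \<sigma>: "0 < \<sigma>" "\<sigma> < s" "s \<le> \<tau>" for \<sigma> s
    proof -
      \<comment> \<open>First \<open>T \<sigma>\<close> smooths into the smaller space, then B T(s -
        \<sigma>) acts within it.\<close>
      define v where "v = inv j (T \<sigma> x)"
      have v: "j v = T \<sigma> x" "norm v \<le> C * \<sigma> powr (- \<alpha>) * norm x"
        using T_inv(1,2)[of \<sigma> x] \<sigma> \<tau> by (auto simp: v_def)
      obtain w where w: "j w = B (T (s - \<sigma>) (j v))" "norm w \<le> C * (s - \<sigma>) powr (- \<beta>) * norm v"
        using BT_V[of "s - \<sigma>" v] \<sigma> \<tau> by auto
      note w(2)
      also have "C * (s - \<sigma>) powr (- \<beta>) * norm v \<le>
          C * (s - \<sigma>) powr (- \<beta>) * (C * \<sigma> powr (- \<alpha>) * norm x)"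
        using v(2) C by (intro mult_left_mono) auto
      finally have "norm w \<le> C * C * (s - \<sigma>) powr (- \<beta>) * \<sigma> powr (- \<alpha>) * norm x"
        by (simp add: mult_ac)
      moreover have "j w = R s x"
        using w(1) v(1) \<sigma> c0_semigroup_add[OF T, of "s - \<sigma>" \<sigma> x] by (simp add: R_def)
      ultimately show ?thesis by blast
    qed
    show "\<exists>w. j w = R s (j u) \<and> norm w \<le> C * s powr (- \<beta>) * norm u" if "0 < s" "s \<le> \<tau>" for s u
      using BT_V[of s u] that \<tau> by (simp add: R_def)
    show "linear (V t)" for t
    proof (cases "0 < t \<and> t \<le> 1")
      case True
      then have "V t = (\<lambda>x. inv j (T t x))" by (auto simp: V_def)
      then show ?thesis using T_inv(3)[of t] True by (simp add: bounded_linear.linear)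
    qed (auto simp: V_def intro!: linearI)
    show "continuous_on {0<..\<tau>} (\<lambda>t. V t x)"
      unfolding continuous_on_eq_continuous_within
    proof
      fix t assume t: "t \<in> {0<..\<tau>}"
      define e where "e = t / 2"
      have e: "0 < e" "e < t" "e \<le> 1" using t \<tau> by (auto simp: e_def)
      have "continuous_on {e..} (\<lambda>r. inv j (T e (T (r - e) x)))"
        by (intro bounded_linear.continuous_on[OF T_inv(3)]
            continuous_on_compose2[OF c0_semigroup_continuous_on[OF T]] continuous_intros) (use e in auto)
      moreover have "T e (T (r - e) x) = T r x" if "e \<le> r" for r
        using c0_semigroup_add[OF T, of e "r - e" x] e that by simp
      ultimately have "continuous_on {e..} (\<lambda>r. inv j (T r x))"
        by (elim continuous_on_eq) auto
      then have "continuous_on {e<..} (\<lambda>r. inv j (T r x))"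
        by (rule continuous_on_subset) auto
      then have "isCont (\<lambda>r. inv j (T r x)) t"
        using e by (simp add: continuous_on_eq_continuous_at)
      then have "continuous (at t within {0<..\<tau>}) (\<lambda>r. inv j (T r x))"
        by (rule continuous_at_imp_continuous_at_within)
      then show "continuous (at t within {0<..\<tau>}) (\<lambda>t. V t x)"
        by (rule continuous_transform_within[OF _ zero_less_one t]) (use \<tau> in \<open>auto simp: V_def\<close>)
    qed
    show "norm (V t x) \<le> C * t powr (- \<alpha>) * norm x" if "0 < t" "t \<le> \<tau>" for t
      using T_inv(2)[of t x] that \<tau> by (simp add: V_def)
    show "norm (V t (j w)) \<le> C * norm w" if "0 < t" "t \<le> \<tau>" for t w
      using T_V[of t w] that \<tau> by (simp add: V_def)
  qed (use j C \<alpha> \<beta> q \<tau> \<tau>_small in auto)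

  obtain L where L: "1 \<le> L" "\<And>t x. \<lbrakk>0 \<le> t; t \<le> 1\<rbrakk> \<Longrightarrow> norm (S t x) \<le> L * norm x"
    using c0_semigroup_bounded[OF S] by metis
  obtain M where "0 < M"
    and M: "\<And>t x. \<lbrakk>0 < t; t \<le> \<tau>\<rbrakk> \<Longrightarrow> \<exists>v. j v = S t x \<and> norm v \<le> M * t powr (- \<alpha>) * norm x"
  proof -
    have "\<exists>M>0. \<forall>t\<in>{0<..\<tau>}. \<forall>x. \<exists>v. j v = S t x \<and> norm v \<le> M * t powr (- \<alpha>) * norm x"
    proof (rule volterra.volterra_solution_smoothing)
      show "norm (S t x) \<le> L * norm x" if "0 \<le> t" "t \<le> \<tau>" for t x using L(2) that \<tau> by simp
      show "0 \<le> L" using L(1) by simp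
      fix t x assume t: "0 < t" "t \<le> \<tau>"
      have "((\<lambda>s. S (t - s) (B (T s x))) has_integral S t x - T t x) {0..t}"
        using t by (intro variation_of_constants[OF T GT diff S GS]) auto
      then have "((\<lambda>s. S (t - s) (R s x)) has_integral S t x - T t x) {0..t}"
        by (rule has_integral_spike[of "{0}", rotated 2]) (auto simp: R_def)
      then show "((\<lambda>s. S (t - s) (R s x)) has_integral S t x - j (V t x)) {0..t}"
        using T_inv(1)[of t x] t \<tau> by (simp add: V_def)
    qed
    then show ?thesis using that by (meson greaterThanAtMost_iff)
  qed

  \<comment> \<open>For \<open>t > \<tau>\<close> the factorisation
    \<open>S \<tau> (S (t - \<tau>) x)\<close> costs
    \<open>M * \<tau> powr (- \<alpha>) * L\<close>, and \<open>t powr (- \<alpha>) \<ge> 1\<close>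
    restores the required form. As \<open>\<tau> powr (- \<alpha>) * L \<ge> 1\<close>, the same
    constant serves for \<open>t \<le> \<tau>\<close>.\<close>
  define C' where "C' = M * \<tau> powr (- \<alpha>) * L"
  have "1 \<le> \<tau> powr (- \<alpha>)" using \<tau> \<alpha> powr_mono2'[of "- \<alpha>" \<tau> 1] by simp
  then have "1 * 1 \<le> \<tau> powr (- \<alpha>) * L" using L(1) by (intro mult_mono) auto
  then have C': "M \<le> C'" "0 < C'" using \<open>0 < M\<close> by (auto simp: C'_def mult.assoc)
  have "opnorm_into_le j (S t) (C' * t powr (- \<alpha>))" if t: "t \<in> {0<..1}" for t
  proof (rule opnorm_into_leI[OF bounded_linear.linear[OF j(1)] j(2)])
    show "linear (S t)" by (simp add: blinfun.bounded_linear_right bounded_linear.linear)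
    show "0 \<le> C' * t powr (- \<alpha>)" using C' by simp
    fix x
    show "\<exists>v. j v = S t x \<and> norm v \<le> C' * t powr (- \<alpha>) * norm x"
    proof (cases "t \<le> \<tau>")
      case True
      then obtain v where v: "j v = S t x" "norm v \<le> M * t powr (- \<alpha>) * norm x"
        using M[of t x] t by auto
      moreover have "M * t powr (- \<alpha>) * norm x \<le> C' * t powr (- \<alpha>) * norm x"
        using C' by (intro mult_right_mono) auto
      ultimately show ?thesis by (intro exI[of _ v]) auto
    next
      case False
      obtain v where v: "j v = S \<tau> (S (t - \<tau>) x)"
          "norm v \<le> M * \<tau> powr (- \<alpha>) * norm (S (t - \<tau>) x)"
        using M[of \<tau> "S (t - \<tau>) x"] \<tau> by auto
      have "M * \<tau> powr (- \<alpha>) * norm (S (t - \<tau>) x) \<le> M * \<tau> powr (- \<alpha>) * (L * norm x)"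
        using L(2)[of "t - \<tau>" x] False t \<tau> \<open>0 < M\<close> by (intro mult_left_mono) auto
      also have "\<dots> = C' * 1 * norm x" by (simp add: C'_def)
      also have "\<dots> \<le> C' * t powr (- \<alpha>) * norm x"
        using t \<alpha> C' powr_mono2'[of "- \<alpha>" t 1] by (intro mult_right_mono mult_left_mono) auto
      finally have "norm v \<le> C' * t powr (- \<alpha>) * norm x" using v(2) by linarith
      moreover have "j v = S t x"
        using v(1) c0_semigroup_add[OF S, of \<tau> "t - \<tau>" x] \<tau> False by simp
      ultimately show ?thesis by blast
    qed
  qed
  then show ?thesis using C' by blast
qed

end
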